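(* Let $q\neq 0$ and let $M$ be a closed connected manifold endowed with an $(O(p+1,q),S^{p,q})$-structure (i.e. endowed with a pseudo-Riemannian metric of signature $(p,q)$ with constant curvature equal to $1$). Then the action of the holonomy group of this structure on $\mathbb{R}^{p+1,q}$ does not preserve any non-degenerate splitting of $\mathbb{R}^{p+1,q}$.
   Context: $\mathbb{R}^{p+1,q}$ is $\mathbb{R}^{p+q+1}$ with the standard pseudo-Euclidean metric $\langle\cdot,\cdot\rangle$ of signature $(p+1,q)$ ($p+1$ positive and $q$ negative directions), $O(p+1,q)$ is its linear isometry group, and $S^{p,q}=\{x\in\mathbb{R}^{p+1,q}\mid\langle x,x\rangle=1\}$ with the induced metric of signature $(p,q)$. Closed means compact without boundary. For a Lie group $G$ acting analytically on a manifold $X$, a $(G,X)$-structure on a manifold $M$ is given by an atlas $(U_i,\varphi_i)$ with each $\varphi_i$ taking values in $X$ and each transition function $\varphi_i\circ\varphi_j^{-1}$ being the restriction of the action of an element of $G$. Given such a structure there are a local diffeomorphism $\delta:\widetilde M\to\widetilde X$ between universal covers (developing map) and a morphism $\rho:\pi_1(M)\to\widetilde G$ (holonomy morphism), where $\widetilde G$ is the covering of $G$ acting on $\widetilde X$, such that $\delta(\gamma\cdot\tilde m)=\rho(\gamma)\cdot\delta(\tilde m)$ for all $\gamma\in\pi_1(M)$ (acting by deck transformations) and $\tilde m\in\widetilde M$. The image $\rho(\pi_1(M))$ is the holonomy group of the $(G,X)$-manifold $M$. (For $G=O(p+1,q)$, $X=S^{p,q}$, which is simply connected unless $p=1$, the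 holonomy group acts on $\mathbb{R}^{p+1,q}$ linearly, through the projection $\widetilde G\to G=O(p+1,q)$.) This is not the holonomy group of the Levi-Civita connection. A non-degenerate splitting of $\mathbb{R}^{p+1,q}$ is a direct sum decomposition $\mathbb{R}^{p+1,q}=V_1\oplus V_2$ into nonzero subspaces on each of which $\langle\cdot,\cdot\rangle$ is nondegenerate; it is preserved by a group if each of $V_1,V_2$ is invariant. *)

theory Defs
  imports "HOL-Analysis.Analysis" "HOL-Algebra.Bij"
begin

section \<open>Pseudo-Euclidean space\<close>

text \<open>
  The set \<open>N\<close> consists of the negative coordinates: the form has signature
  \<open>(card (- N), card N)\<close>, so that the space is $\mathbb{R}^{p+1,q}$ when
  \<open>card (- N) = p + 1\<close> and \<open>card N = q\<close>.
\<close>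

definition pform :: "'n::finite set \<Rightarrow> real ^ 'n \<Rightarrow> real ^ 'n \<Rightarrow> real" where
  "pform N x y = (\<Sum>i\<in>- N. x $ i * y $ i) - (\<Sum>i\<in>N. x $ i * y $ i)"

definition linear_isometries :: "'n::finite set \<Rightarrow> (real ^ 'n \<Rightarrow> real ^ 'n) set" where
  "linear_isometries N = {g. linear g \<and> (\<forall>x y. pform N (g x) (g y) = pform N x y)}"

definition pseudosphere :: "'n::finite set \<Rightarrow> (real ^ 'n) set" where
  "pseudosphere N = {x. pform N x x = 1}"

definition nondegenerate_on :: "'n::finite set \<Rightarrow> (real ^ 'n) set \<Rightarrow> bool" where
  "nondegenerate_on N V \<longleftrightarrow> (\<forall>v\<in>V. (\<forall>w\<in>V. pform N v w = 0) \<longrightarrow> v = 0)"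

text \<open>The two summands are not required to be orthogonal.\<close>

definition nondegenerate_splitting ::
  "'n::finite set \<Rightarrow> (real ^ 'n) set \<Rightarrow> (real ^ 'n) set \<Rightarrow> bool" where
  "nondegenerate_splitting N V1 V2 \<longleftrightarrow>
     subspace V1 \<and> subspace V2 \<and> V1 \<noteq> {0} \<and> V2 \<noteq> {0} \<and>
     V1 \<inter> V2 = {0} \<and> {v1 + v2 | v1 v2. v1 \<in> V1 \<and> v2 \<in> V2} = UNIV \<and>
     nondegenerate_on N V1 \<and> nondegenerate_on N V2"

definition preserves_splitting :: "('v \<Rightarrow> 'v) set \<Rightarrow> 'v set \<Rightarrow> 'v set \<Rightarrow> bool" where
  "preserves_splitting H V1 V2 \<longleftrightarrow> (\<forall>g\<in>H. g ` V1 \<subseteq> V1 \<and> g ` V2 \<subseteq> V2)"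


section \<open>$(G,X)$-structures\<close>

text \<open>
  The group \<open>G\<close> is given by the transformations through which it acts on \<open>X\<close>.
  As usual, a transition function is required to agree with elements of \<open>G\<close> only locally, so
  that on a disconnected overlap the element may depend on the component; atlases
  whose transition functions are each given by a single element are a special case.
  Since the charts are homeomorphisms onto open subsets of \<open>X\<close>, the atlas also contains the
  manifold structure of \<open>M\<close>.
\<close>

definition gx_structure ::
  "('x \<Rightarrow> 'x) set \<Rightarrow> 'x::topological_space set \<Rightarrow> 'm::topological_space set \<Rightarrow>
   ('m set \<times> ('m \<Rightarrow> 'x)) set \<Rightarrow> bool" where
  "gx_structure G X M \<A> \<longleftrightarrow>
     (\<Union>(U, \<phi>)\<in>\<A>. U) = M \<and>
     (\<forall>(U, \<phi>)\<in>\<A>. openin (top_of_set M) U \<and>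
        (\<exists>V \<phi>'. openin (top_of_set X) V \<and> homeomorphism U V \<phi> \<phi>')) \<and>
     (\<forall>(U, \<phi>)\<in>\<A>. \<forall>(V, \<psi>)\<in>\<A>. \<forall>m\<in>U \<inter> V.
        \<exists>W. \<exists>g\<in>G. openin (top_of_set M) W \<and> m \<in> W \<and> W \<subseteq> U \<inter> V \<and>
          (\<forall>w\<in>W. \<phi> w = g (\<psi> w)))"


section \<open>Universal coverings and lifted groups\<close>

text \<open>
  For connected \<open>B\<close> this says that the total space is simply connected. The componentwise form
  is needed because the pseudosphere of signature $(0,q)$ is a two-sheeted hyperboloid.
\<close>

definition universal_covering ::
  "'e::topological_space set \<Rightarrow> ('e \<Rightarrow> 'b) \<Rightarrow> 'b::topological_space set \<Rightarrow> bool" where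
  "universal_covering E \<pi> B \<longleftrightarrow>
     covering_space E \<pi> B \<and> (\<forall>C\<in>components B. simply_connected (E \<inter> \<pi> -` C))"

text \<open>
  All lifts to \<open>E\<close> of the transformations in \<open>G\<close>. For the universal covering of \<open>X\<close> this is the
  group $\widetilde G$, with projection to \<open>G\<close> sending a lift to the transformation it covers.
\<close>

definition lifted_group ::
  "('b \<Rightarrow> 'b) set \<Rightarrow> 'e::topological_space set \<Rightarrow> ('e \<Rightarrow> 'b) \<Rightarrow> ('e \<Rightarrow> 'e) monoid" where
  "lifted_group G E \<pi> = (BijGroup E)\<lparr>carrier :=
     {h \<in> Bij E. (\<exists>h'. homeomorphism E E h h') \<and> (\<exists>g\<in>G. \<forall>e\<in>E. \<pi> (h e) = g (\<pi> e))}\<rparr>"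

text \<open>On the universal covering of \<open>M\<close> this is $\pi_1(M)$ with its action.\<close>

definition deck_group :: "'e::topological_space set \<Rightarrow> ('e \<Rightarrow> 'b) \<Rightarrow> ('e \<Rightarrow> 'e) monoid" where
  "deck_group E \<pi> = lifted_group {id} E \<pi>"


section \<open>Developing map and holonomy\<close>

text \<open>
  Here \<open>\<pi> : Mt \<rightarrow> M\<close> and \<open>r : Xt \<rightarrow> X\<close> are universal coverings. In the charts of \<open>M\<close> a developing
  map is given by elements of \<open>G\<close>; together with continuity this makes it a local
  diffeomorphism, as \<open>\<pi>\<close>, \<open>r\<close> and the charts are local diffeomorphisms.
\<close>

definition developing_map ::
  "('x \<Rightarrow> 'x) set \<Rightarrow> ('m::topological_space set \<times> ('m \<Rightarrow> 'x)) set \<Rightarrow>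
   'u::topological_space set \<Rightarrow> ('u \<Rightarrow> 'm) \<Rightarrow> 'v::topological_space set \<Rightarrow> ('v \<Rightarrow> 'x) \<Rightarrow>
   ('u \<Rightarrow> 'v) \<Rightarrow> bool" where
  "developing_map G \<A> Mt \<pi> Xt r \<delta> \<longleftrightarrow>
     continuous_on Mt \<delta> \<and> \<delta> \<in> Mt \<rightarrow> Xt \<and>
     (\<forall>(U, \<phi>)\<in>\<A>. \<forall>m\<in>Mt \<inter> \<pi> -` U.
        \<exists>W. \<exists>g\<in>G. openin (top_of_set Mt) W \<and> m \<in> W \<and> \<pi> ` W \<subseteq> U \<and>
          (\<forall>w\<in>W. r (\<delta> w) = g (\<phi> (\<pi> w))))"

definition holonomy_morphism ::
  "('x \<Rightarrow> 'x) set \<Rightarrow> 'u::topological_space set \<Rightarrow> ('u \<Rightarrow> 'm) \<Rightarrow>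
   'v::topological_space set \<Rightarrow> ('v \<Rightarrow> 'x) \<Rightarrow> ('u \<Rightarrow> 'v) \<Rightarrow> (('u \<Rightarrow> 'u) \<Rightarrow> ('v \<Rightarrow> 'v)) \<Rightarrow> bool" where
  "holonomy_morphism G Mt \<pi> Xt r \<delta> \<rho> \<longleftrightarrow>
     \<rho> \<in> hom (deck_group Mt \<pi>) (lifted_group G Xt r) \<and>
     (\<forall>\<gamma>\<in>carrier (deck_group Mt \<pi>). \<forall>m\<in>Mt. \<delta> (\<gamma> m) = \<rho> \<gamma> (\<delta> m))"

definition holonomy_group ::
  "'u::topological_space set \<Rightarrow> ('u \<Rightarrow> 'm) \<Rightarrow> (('u \<Rightarrow> 'u) \<Rightarrow> ('v \<Rightarrow> 'v)) \<Rightarrow> ('v \<Rightarrow> 'v) set" where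
  "holonomy_group Mt \<pi> \<rho> = \<rho> ` carrier (deck_group Mt \<pi>)"

text \<open>The image in \<open>G\<close> of a set \<open>H\<close> of lifts.\<close>

definition projected_group ::
  "('x \<Rightarrow> 'x) set \<Rightarrow> 'v set \<Rightarrow> ('v \<Rightarrow> 'x) \<Rightarrow> ('v \<Rightarrow> 'v) set \<Rightarrow> ('x \<Rightarrow> 'x) set" where
  "projected_group G Xt r H = {g \<in> G. \<exists>h\<in>H. \<forall>x\<in>Xt. r (h x) = g (r x)}"

end

theory Submission
  imports Defs
begin

text \<open>
  Suppose that the holonomy group preserves a nondegenerate splitting with summand \<open>V\<close>. Being
  made of isometries, it also preserves the orthogonal complement of \<open>V\<close>, which now takes the place
  of the second summand, and it commutes with the orthogonal projection \<open>P\<close> onto \<open>V\<close>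
  (\<open>pproj_isometry\<close>). The function $x \mapsto \langle Px, Px\rangle$ is then invariant under
  holonomy. Its pullback under the developing map takes the same value at any two points of a fibre
  of the universal covering, since deck transformations act transitively on the fibres
  (\<open>deck_group_transitive_on_fibres\<close>); so it descends to the compact manifold \<open>M\<close> and attains
  a maximum and a minimum. As the developing map is open, these become local extrema of
  $\langle Px, Px\rangle$ on the pseudosphere.

  Such extrema cannot both exist (\<open>no_local_extrema_of_pproj\<close>). At a local maximum \<open>x\<close> with value
  $\alpha$, Lagrange multipliers and homogeneity give $\langle Px, Pu\rangle = \alpha\langle x, u\rangle$
  and $\langle Pu, Pu\rangle \le \alpha\langle u, u\rangle$ for all vectors \<open>u\<close>
  (\<open>quadratic_local_max_on_pseudosphere\<close>). The first relation forces $\alpha \in \{0, 1\}$, and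
  then the second says that the form is nonpositive on \<open>V\<close> or nonnegative on its complement. A local
  minimum gives in the same way that the form is nonnegative on \<open>V\<close> or nonpositive on the complement.
  Of the four combinations, two make the form vanish on \<open>V\<close> or on its complement, against
  nondegeneracy; one makes the form nonpositive everywhere, although it equals 1 on the
  pseudosphere; and one makes it nonnegative everywhere, which is excluded by $q \neq 0$.

  Transitivity on fibres rests on the lifting criterion
  \<open>covering_space_lift_simply_connected\<close> for coverings of topological spaces, which comes
  from lifting paths and free homotopies of loops.
\<close>

section \<open>The pseudo-Euclidean form\<close>

text \<open>
  The Gram matrix of the form: it carries facts about orthogonal complements and dimensions over from the
  Euclidean inner product.
\<close>

definition signflip :: "'n::finite set \<Rightarrow> real ^ 'n \<Rightarrow> real ^ 'n" where
  "signflip N x = (\<chi> i. if i \<in> N then - x $ i else x $ i)"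

lemma linear_signflip: "linear (signflip N)"
  by (rule linearI) (auto simp: signflip_def vec_eq_iff)

lemma signflip_signflip: "signflip N (signflip N x) = x"
  by (simp add: signflip_def vec_eq_iff)

lemma pform_eq_inner: "pform N x y = signflip N x \<bullet> y"
proof -
  have "signflip N x \<bullet> y = (\<Sum>i\<in>N \<union> - N. (if i \<in> N then - x $ i else x $ i) * y $ i)"
    by (simp add: inner_vec_def signflip_def)
  also have "\<dots> = (\<Sum>i\<in>N. - (x $ i * y $ i)) + (\<Sum>i\<in>- N. x $ i * y $ i)"
    by (subst sum.union_disjoint) (auto intro!: arg_cong2[of _ _ _ _ "(+)"] sum.cong)
  finally show ?thesis by (simp add: pform_def sum_negf)
qed

lemma bilinear_pform: "bilinear (pform N)"
  unfolding pform_eq_inner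
  using linear_signflip[of N]
  by (auto simp: bilinear_def linear_iff inner_add_left inner_add_right)

lemma pform_commute: "pform N x y = pform N y x"
  by (simp add: pform_def mult.commute)

lemma pform_nondegenerate:
  assumes "\<And>y. pform N x y = 0" shows "x = 0"
proof -
  have "signflip N x \<bullet> signflip N x = 0" using assms by (simp add: pform_eq_inner)
  then have "signflip N (signflip N x) = signflip N 0" by simp
  then show ?thesis by (simp only: signflip_signflip linear_0[OF linear_signflip])
qed

lemma continuous_on_pform [continuous_intros]:
  assumes "continuous_on S f" "continuous_on S g"
  shows "continuous_on S (\<lambda>x. pform N (f x) (g x))"
  unfolding pform_def by (intro continuous_intros assms)

lemma pform_axis: "pform N (axis i 1) (axis i 1) = (if i \<in> N then - 1 else 1)"
proof -
  have "signflip N (axis i 1) \<bullet> axis i 1 = (if i \<in> N then - 1 else 1)"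
    by (simp add: inner_axis signflip_def)
  then show ?thesis by (simp add: pform_eq_inner)
qed

lemma linear_isometries_inj:
  assumes "g \<in> linear_isometries N" shows "inj g"
proof -
  have "x = 0" if "g x = 0" for x
  proof (rule pform_nondegenerate[of N])
    fix y
    have "pform N x y = pform N (g x) (g y)" using assms by (simp add: linear_isometries_def)
    then show "pform N x y = 0" by (simp add: that bilinear_lzero[OF bilinear_pform])
  qed
  then show ?thesis
    using assms linear_injective_0[of g] by (auto simp: linear_isometries_def)
qed

lemma linear_isometries_homeomorphism_pseudosphere:
  assumes g: "g \<in> linear_isometries N"
  obtains g' where "homeomorphism (pseudosphere N) (pseudosphere N) g g'"
proof -
  have lin: "linear g" and iso: "\<And>x y. pform N (g x) (g y) = pform N x y"
    using g by (auto simp: linear_isometries_def)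
  obtain g' where g': "linear g'" "\<And>x. g' (g x) = x" "\<And>x. g (g' x) = x"
    using linear_injective_isomorphism[OF lin linear_isometries_inj[OF g]] by blast
  have iso': "pform N (g' x) (g' y) = pform N x y" for x y
    using iso[of "g' x" "g' y"] g'(3) by simp
  have "homeomorphism (pseudosphere N) (pseudosphere N) g g'"
    by (rule homeomorphismI)
      (use g' lin iso iso' in \<open>auto simp: pseudosphere_def linear_continuous_on linear_linear\<close>)
  then show ?thesis by (rule that)
qed

text \<open>
  The open set of spacelike vectors is locally path connected, and radial projection retracts it onto the
  pseudosphere.
\<close>

lemma locally_path_connected_pseudosphere: "locally path_connected (pseudosphere N)"
proof (rule retract_of_locally_path_connected)
  let ?C = "{x. 0 < pform N x x}"
  have "open ?C" by (intro open_Collect_less continuous_intros)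
  then show "locally path_connected ?C" by (rule open_imp_locally_path_connected)
  have "retraction ?C (pseudosphere N) (\<lambda>x. x /\<^sub>R sqrt (pform N x x))"
    unfolding retraction_def pseudosphere_def
    by (auto intro!: continuous_intros
        simp: bilinear_lmul[OF bilinear_pform] bilinear_rmul[OF bilinear_pform] field_simps)
  then show "pseudosphere N retract_of ?C" by (auto simp: retract_of_def)
qed

section \<open>Orthogonal projection to a nondegenerate subspace\<close>

definition perp :: "'n::finite set \<Rightarrow> (real ^ 'n) set \<Rightarrow> (real ^ 'n) set" where
  "perp N V = {w. \<forall>v\<in>V. pform N v w = 0}"

lemma subspace_perp: "subspace (perp N V)"
  unfolding perp_def subspace_def
  by (auto simp: bilinear_radd[OF bilinear_pform] bilinear_rmul[OF bilinear_pform]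
      bilinear_rzero[OF bilinear_pform])

lemma perp_Int_nondegenerate:
  assumes "nondegenerate_on N V" "x \<in> V" "x \<in> perp N V"
  shows "x = 0"
  using assms by (auto simp: nondegenerate_on_def perp_def pform_commute)

text \<open>
  The complement of \<open>V\<close> is the Euclidean complement of \<open>signflip N ` V\<close>, hence has
  complementary dimension; nondegeneracy makes the sum direct, so it exhausts the space.
\<close>

lemma nondegenerate_decomposition:
  fixes V :: "(real ^ 'n::finite) set"
  assumes V: "subspace V" "nondegenerate_on N V"
  shows "\<exists>v\<in>V. x - v \<in> perp N V"
proof -
  have inj: "inj (signflip N)" by (metis injI signflip_signflip)
  have "dim {w \<in> UNIV. \<forall>y\<in>signflip N ` V. orthogonal y w} + dim (signflip N ` V) = dim (UNIV :: (real^'n) set)"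
    by (rule dim_subspace_orthogonal_to_vectors)
      (auto intro!: linear_subspace_image linear_signflip V)
  moreover have "{w \<in> UNIV. \<forall>y\<in>signflip N ` V. orthogonal y w} = perp N V"
    by (auto simp: perp_def orthogonal_def pform_eq_inner)
  moreover have "dim (signflip N ` V) = dim V"
    using inj by (intro dim_image_eq linear_signflip) (auto simp: inj_on_def)
  moreover have "V \<inter> perp N V = {0}"
    using perp_Int_nondegenerate[OF V(2)] subspace_0[OF V(1)] subspace_0[OF subspace_perp] by blast
  ultimately have "dim {v + w |v w. v \<in> V \<and> w \<in> perp N V} = dim (UNIV :: (real^'n) set)"
    using dim_sums_Int[OF V(1) subspace_perp[of N V]] by simp
  then have "{v + w |v w. v \<in> V \<and> w \<in> perp N V} = UNIV"
    by (intro subspace_dim_equal subspace_sums V subspace_perp) auto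
  then obtain v w where "v \<in> V" "w \<in> perp N V" "x = v + w" by blast
  then show ?thesis by (intro bexI [of _ v]) simp_all
qed

definition pproj :: "'n::finite set \<Rightarrow> (real ^ 'n) set \<Rightarrow> real ^ 'n \<Rightarrow> real ^ 'n" where
  "pproj N V x = (THE v. v \<in> V \<and> x - v \<in> perp N V)"

lemma pproj_eqI:
  assumes V: "subspace V" "nondegenerate_on N V" and v: "v \<in> V" "x - v \<in> perp N V"
  shows "pproj N V x = v"
  unfolding pproj_def
proof (rule the_equality)
  fix v' assume v': "v' \<in> V \<and> x - v' \<in> perp N V"
  have "(x - v) - (x - v') \<in> perp N V" using v v' subspace_diff[OF subspace_perp] by blast
  then have "v' - v \<in> perp N V" by (simp add: algebra_simps)
  moreover have "v' - v \<in> V" using v v' subspace_diff[OF V(1)] by blast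
  ultimately have "v' - v = 0" using perp_Int_nondegenerate[OF V(2)] by blast
  then show "v' = v" by simp
qed (use v in blast)

lemma
  assumes V: "subspace V" "nondegenerate_on N V"
  shows pproj_in: "pproj N V x \<in> V" and diff_pproj_in: "x - pproj N V x \<in> perp N V"
  using nondegenerate_decomposition[OF V, of x] pproj_eqI[OF V] by metis+

lemma linear_pproj:
  fixes V :: "(real ^ 'n::finite) set"
  assumes V: "subspace V" "nondegenerate_on N V"
  shows "linear (pproj N V)"
proof (rule linearI)
  note in_V = pproj_in[OF V] and in_perp = diff_pproj_in[OF V]
  fix x y :: "real ^ 'n" and c :: real
  show "pproj N V (x + y) = pproj N V x + pproj N V y"
    using subspace_add[OF subspace_perp in_perp[of x] in_perp[of y]]
    by (intro pproj_eqI V subspace_add in_V) (simp add: algebra_simps)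
  show "pproj N V (c *\<^sub>R x) = c *\<^sub>R pproj N V x"
    using subspace_scale[OF subspace_perp in_perp[of x], of c]
    by (intro pproj_eqI V subspace_scale in_V) (simp add: algebra_simps)
qed

text \<open>An isometry that leaves \<open>V\<close> invariant maps it onto itself, hence also respects its complement.\<close>

lemma pproj_isometry:
  assumes V: "subspace V" "nondegenerate_on N V"
    and g: "g \<in> linear_isometries N" "g ` V \<subseteq> V"
  shows "pproj N V (g x) = g (pproj N V x)"
proof (rule pproj_eqI[OF V])
  have lin: "linear g" and iso: "\<And>x y. pform N (g x) (g y) = pform N x y"
    using g(1) by (auto simp: linear_isometries_def)
  have "dim (g ` V) = dim V"
    using linear_isometries_inj[OF g(1)] by (intro dim_image_eq lin) (auto simp: inj_on_def)
  then have gV: "g ` V = V"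
    using g(2) by (intro subspace_dim_equal linear_subspace_image lin V) auto
  show "g (pproj N V x) \<in> V" using gV pproj_in[OF V] by blast
  have "pform N v (g (x - pproj N V x)) = 0" if "v \<in> V" for v
  proof -
    obtain v' where "v = g v'" "v' \<in> V" using gV \<open>v \<in> V\<close> by blast
    then show ?thesis using iso diff_pproj_in[OF V, of x] by (simp add: perp_def)
  qed
  then show "g x - g (pproj N V x) \<in> perp N V"
    by (simp add: perp_def linear_diff[OF lin])
qed

section \<open>Quadratic functions on the pseudosphere\<close>

lemma quadratic_nonpos_near_0:
  fixes c d :: real
  assumes "\<forall>\<^sub>F t in at 0. 2 * t * c + t\<^sup>2 * d \<le> 0"
  shows "c = 0" "d \<le> 0"
proof -
  obtain \<epsilon> where \<epsilon>: "\<epsilon> > 0" "\<And>t. t \<noteq> 0 \<Longrightarrow> \<bar>t\<bar> < \<epsilon> \<Longrightarrow> 2 * t * c + t\<^sup>2 * d \<le> 0"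
    using assms unfolding eventually_at by (auto simp: dist_real_def)
  have "2 * (\<epsilon>/2) * c + (\<epsilon>/2)\<^sup>2 * d \<le> 0" "2 * (-(\<epsilon>/2)) * c + (-(\<epsilon>/2))\<^sup>2 * d \<le> 0"
    using \<epsilon> by (intro \<epsilon>(2); simp)+
  then have "(\<epsilon>/2)\<^sup>2 * d \<le> 0" unfolding power2_minus by linarith
  then show "d \<le> 0" using \<epsilon>(1) by (simp add: mult_le_0_iff)
  show "c = 0"
  proof (rule ccontr)
    assume c: "c \<noteq> 0"
    \<comment> \<open>so small that the quadratic term stays below the linear one\<close>
    define s where "s = min (\<epsilon>/2) (\<bar>c\<bar> / (\<bar>d\<bar> + 1))"
    have s: "s > 0" "s < \<epsilon>" using \<epsilon>(1) c by (auto simp: s_def)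
    have "s * \<bar>d\<bar> \<le> \<bar>c\<bar> / (\<bar>d\<bar> + 1) * \<bar>d\<bar>" by (intro mult_right_mono) (auto simp: s_def)
    also have "\<dots> \<le> \<bar>c\<bar>" by (simp add: field_simps)
    finally have sd: "s * \<bar>d\<bar> \<le> \<bar>c\<bar>" .
    have "2 * (sgn c * s) * c + (sgn c * s)\<^sup>2 * d \<le> 0"
      using s c by (intro \<epsilon>(2)) (auto simp: abs_mult sgn_if)
    then have "s * (2 * \<bar>c\<bar> + s * d) \<le> 0"
      using c by (cases "c > 0") (auto simp: sgn_if power2_eq_square algebra_simps)
    then have "2 * \<bar>c\<bar> + s * d \<le> 0" using s(1) by (simp add: mult_le_0_iff)
    moreover have "- (s * \<bar>d\<bar>) \<le> s * d" using s(1) by (cases "d \<ge> 0") auto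
    ultimately show False using sd c by linarith
  qed
qed

text \<open>
  By homogeneity, a local maximum \<open>\<alpha>\<close> of \<open>A y y\<close> on the pseudosphere makes the quadratic
  form \<open>A y y - \<alpha> * pform N y y\<close> nonpositive near \<open>x\<close>, where it vanishes. A quadratic form
  with a local maximum at one of its zeros is nonpositive everywhere.
\<close>

lemma quadratic_local_max_on_pseudosphere:
  assumes A: "bilinear A" "\<And>x y. A x y = A y x"
    and W: "openin (top_of_set (pseudosphere N)) W" "x \<in> W"
    and max: "\<And>y. y \<in> W \<Longrightarrow> A y y \<le> A x x"
  shows "A x u = A x x * pform N x u" "A u u \<le> A x x * pform N u u"
proof -
  note B = bilinear_pform[of N]
  obtain W' where W': "open W'" "W = pseudosphere N \<inter> W'" using W(1) by (auto simp: openin_open)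
  have x: "pform N x x = 1" using W(2) W'(2) by (simp add: pseudosphere_def)
  define b where "b t = pform N (x + t *\<^sub>R u) (x + t *\<^sub>R u)" for t
  define n where "n t = (x + t *\<^sub>R u) /\<^sub>R sqrt (b t)" for t
  have cont: "isCont b 0"
    unfolding b_def pform_def by (intro continuous_intros)
  have pos: "\<forall>\<^sub>F t in at 0. 0 < b t"
    using cont x by (intro order_tendstoD[of b "b 0"]) (auto simp: isCont_def b_def)
  have "isCont n 0"
    unfolding n_def using x by (intro continuous_intros cont) (simp add: b_def)
  then have "(n \<longlongrightarrow> x) (at 0)" using x by (simp add: isCont_def n_def b_def)
  then have near: "\<forall>\<^sub>F t in at 0. n t \<in> W'"
    using W' W(2) by (intro topological_tendstoD) auto
  have "\<forall>\<^sub>F t in at 0. 2 * t * (A x u - A x x * pform N x u)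
      + t\<^sup>2 * (A u u - A x x * pform N u u) \<le> 0"
    using pos near
  proof eventually_elim
    case (elim t)
    let ?y = "x + t *\<^sub>R u"
    have scale: "inverse (sqrt (b t)) * (inverse (sqrt (b t)) * z) = z / b t" for z
      using elim(1) by (simp add: field_simps)
    have "pform N (n t) (n t) = b t / b t"
      unfolding n_def bilinear_lmul[OF B] bilinear_rmul[OF B] real_scaleR_def scale
      by (simp add: b_def)
    then have "pform N (n t) (n t) = 1" using elim(1) by simp
    then have "n t \<in> W" using elim(2) W'(2) by (simp add: pseudosphere_def)
    then have "A (n t) (n t) \<le> A x x" by (rule max)
    moreover have "A (n t) (n t) = A ?y ?y / b t"
      unfolding n_def bilinear_lmul[OF A(1)] bilinear_rmul[OF A(1)] real_scaleR_def scale ..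
    ultimately have le: "A ?y ?y \<le> A x x * b t" using elim(1) by (simp add: divide_le_eq)
    have "A ?y ?y = A x x + 2 * t * A x u + t\<^sup>2 * A u u"
      by (simp add: bilinear_ladd[OF A(1)] bilinear_radd[OF A(1)] bilinear_lmul[OF A(1)]
          bilinear_rmul[OF A(1)] A(2)[of u x] power2_eq_square algebra_simps)
    moreover have "b t = 1 + 2 * t * pform N x u + t\<^sup>2 * pform N u u"
      by (simp add: b_def bilinear_ladd[OF B] bilinear_radd[OF B] bilinear_lmul[OF B]
          bilinear_rmul[OF B] pform_commute[of N u x] x power2_eq_square algebra_simps)
    ultimately show ?case using le by (simp add: algebra_simps)
  qed
  from quadratic_nonpos_near_0[OF this]
  show "A x u = A x x * pform N x u" "A u u \<le> A x x * pform N u u" by simp_all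
qed

text \<open>
  Polarization makes any two elements of \<open>K\<close> orthogonal; as every vector
  differs from one in \<open>K\<close> by a vector orthogonal to \<open>K\<close>, the elements of \<open>K\<close> are orthogonal to everything.
\<close>

lemma isotropic_complemented_trivial:
  assumes K: "subspace K" and iso: "\<And>x. x \<in> K \<Longrightarrow> pform N x x = 0"
    and compl: "\<And>u. \<exists>v\<in>K. \<forall>x\<in>K. pform N x (u - v) = 0"
    and x: "x \<in> K"
  shows "x = 0"
proof (rule pform_nondegenerate)
  note B = bilinear_pform[of N]
  fix u
  obtain v where v: "v \<in> K" "pform N x (u - v) = 0" using compl x by blast
  have "pform N (x + v) (x + v) = pform N x x + 2 * pform N x v + pform N v v"
    by (simp add: bilinear_ladd[OF B] bilinear_radd[OF B] pform_commute[of N v x])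
  then have "pform N x v = 0" using iso x v(1) subspace_add[OF K x v(1)] by simp
  then show "pform N x u = 0" using v(2) by (simp add: bilinear_rsub[OF B])
qed

text \<open>
  The maximum makes \<open>V\<close> seminegative or its complement semipositive, the minimum makes \<open>V\<close>
  semipositive or its complement seminegative, and no two of these alternatives fit together.
\<close>

lemma no_local_extrema_of_pproj:
  assumes V: "subspace V" "nondegenerate_on N V" "V \<noteq> {0}" "V \<noteq> UNIV" and N: "N \<noteq> {}"
    and W: "openin (top_of_set (pseudosphere N)) W" "x \<in> W"
      "\<And>y. y \<in> W \<Longrightarrow> pform N (pproj N V y) (pproj N V y) \<le> pform N (pproj N V x) (pproj N V x)"
    and W': "openin (top_of_set (pseudosphere N)) W'" "x' \<in> W'"
      "\<And>y. y \<in> W' \<Longrightarrow> pform N (pproj N V x') (pproj N V x') \<le> pform N (pproj N V y) (pproj N V y)"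
  shows False
proof -
  let ?P = "pproj N V"
  define A where "A y z = pform N (?P y) (?P z)" for y z
  note B = bilinear_pform[of N] and P = linear_pproj[OF V(1,2)]
  note in_V = pproj_in[OF V(1,2)] and in_perp = diff_pproj_in[OF V(1,2)]
  have P_V: "?P v = v" if "v \<in> V" for v
    by (rule pproj_eqI[OF V(1,2)]) (use that subspace_0[OF subspace_perp] in auto)
  have P_perp: "?P w = 0" if "w \<in> perp N V" for w
    by (rule pproj_eqI[OF V(1,2)]) (use that subspace_0[OF V(1)] in auto)
  have bil: "bilinear A" "bilinear (\<lambda>y z. - A y z)"
    using B P by (auto simp: A_def bilinear_def linear_iff)
  have comm: "A y z = A z y" for y z by (simp add: A_def pform_commute)
  have A_V: "A v v = pform N v v" if "v \<in> V" for v using P_V that by (simp add: A_def)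
  have A_perp: "A w w = 0" if "w \<in> perp N V" for w
    using P_perp that by (simp add: A_def bilinear_lzero[OF B])
  have A_P: "A y (?P y) = pform N y (?P y)" "A y y = A y (?P y)" for y
  proof -
    have "pform N (?P y) (y - ?P y) = 0" using in_perp in_V by (simp add: perp_def)
    then show "A y (?P y) = pform N y (?P y)"
      using P_V[OF in_V] by (simp add: A_def bilinear_rsub[OF B] pform_commute[of N y])
    show "A y y = A y (?P y)" using P_V[OF in_V] by (simp add: A_def)
  qed

  define \<alpha> \<beta> where "\<alpha> = A x x" and "\<beta> = A x' x'"
  have max: "A x u = \<alpha> * pform N x u" "A u u \<le> \<alpha> * pform N u u" for u
    using quadratic_local_max_on_pseudosphere[OF bil(1) comm W(1,2), of u] W(3)
    by (simp_all add: A_def \<alpha>_def)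
  have min: "A x' u = \<beta> * pform N x' u" "A u u \<ge> \<beta> * pform N u u" for u
    using quadratic_local_max_on_pseudosphere[OF bil(2) _ W'(1,2), of u] W'(3) comm
    by (simp_all add: A_def \<beta>_def)
  \<comment> \<open>the extremal values are eigenvalues of the projection\<close>
  have "\<alpha> = 0 \<or> \<alpha> = 1" "\<beta> = 0 \<or> \<beta> = 1"
    using max(1)[of "?P x"] min(1)[of "?P x'"] A_P[of x] A_P[of x'] by (auto simp: \<alpha>_def \<beta>_def)
  then have sgn: "(\<forall>v\<in>V. pform N v v \<le> 0) \<or> (\<forall>w\<in>perp N V. 0 \<le> pform N w w)"
      "(\<forall>v\<in>V. 0 \<le> pform N v v) \<or> (\<forall>w\<in>perp N V. pform N w w \<le> 0)"
    using max(2) min(2) A_V A_perp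
    by (metis mult_zero_left mult_1)+
  have split: "pform N y y = pform N (?P y) (?P y) + pform N (y - ?P y) (y - ?P y)" for y
  proof -
    have "pform N (?P y) (y - ?P y) = 0" using in_perp in_V by (simp add: perp_def)
    then show ?thesis
      by (simp add: bilinear_rsub[OF B] bilinear_lsub[OF B] pform_commute[of N y "?P y"])
  qed
  have V_not_isotropic: False if "\<forall>v\<in>V. pform N v v = 0"
  proof -
    have "v = 0" if "v \<in> V" for v
    proof (rule isotropic_complemented_trivial[OF V(1) _ _ that])
      show "\<exists>v\<in>V. \<forall>x\<in>V. pform N x (u - v) = 0" for u
        using in_V[of u] in_perp[of u] by (auto simp: perp_def)
    qed (use \<open>\<forall>v\<in>V. pform N v v = 0\<close> in auto)
    then show False using V(3) subspace_0[OF V(1)] by blast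
  qed
  have perp_not_isotropic: False if "\<forall>w\<in>perp N V. pform N w w = 0"
  proof -
    have "w = 0" if "w \<in> perp N V" for w
    proof (rule isotropic_complemented_trivial[OF subspace_perp _ _ that])
      show "\<exists>v\<in>perp N V. \<forall>x\<in>perp N V. pform N x (u - v) = 0" for u
        using in_V[of u] in_perp[of u]
        by (intro bexI [of _ "u - ?P u"]) (auto simp: perp_def pform_commute)
    qed (use \<open>\<forall>w\<in>perp N V. pform N w w = 0\<close> in auto)
    then have "y = ?P y" for y using in_perp[of y] by force
    then have "V = UNIV" using in_V by (metis UNIV_eq_I)
    then show False using V(4) by blast
  qed
  consider "\<forall>v\<in>V. pform N v v \<le> 0" "\<forall>v\<in>V. 0 \<le> pform N v v"
    | "\<forall>v\<in>V. pform N v v \<le> 0" "\<forall>w\<in>perp N V. pform N w w \<le> 0"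
    | "\<forall>w\<in>perp N V. 0 \<le> pform N w w" "\<forall>v\<in>V. 0 \<le> pform N v v"
    | "\<forall>w\<in>perp N V. 0 \<le> pform N w w" "\<forall>w\<in>perp N V. pform N w w \<le> 0"
    using sgn by blast
  then show False
  proof cases
    case 1
    then show ?thesis using V_not_isotropic by force
  next
    case 2
    have "pform N x x = 1" using W(1,2) openin_imp_subset by (force simp: pseudosphere_def)
    moreover have "pform N x x \<le> 0" using split[of x] 2 in_V[of x] in_perp[of x] by force
    ultimately show ?thesis by simp
  next
    case 3
    obtain i where "i \<in> N" using N by blast
    then have "pform N (axis i 1) (axis i 1) = - 1" by (simp add: pform_axis)
    moreover have "0 \<le> pform N (axis i 1) (axis i 1)"
      using split[of "axis i 1"] 3 in_V[of "axis i 1"] in_perp[of "axis i 1"] by force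
    ultimately show ?thesis by simp
  next
    case 4
    then show ?thesis using perp_not_isotropic by force
  qed
qed

section \<open>Lifting through coverings of topological spaces\<close>

lemma continuous_on_locally:
  assumes "\<And>x. x \<in> S \<Longrightarrow> \<exists>U. openin (top_of_set S) U \<and> x \<in> U \<and> continuous_on U f"
  shows "continuous_on S f"
  unfolding continuous_on_topological
proof (intro ballI allI impI)
  fix x B assume x: "x \<in> S" and B: "open B" "f x \<in> B"
  obtain U where U: "openin (top_of_set S) U" "x \<in> U" "continuous_on U f"
    using assms x by blast
  obtain U' where U': "open U'" "U = S \<inter> U'" using U(1) by (auto simp: openin_open)
  obtain A where A: "open A" "x \<in> A" "\<forall>y\<in>U. y \<in> A \<longrightarrow> f y \<in> B"
    using U(2,3) B unfolding continuous_on_topological by blast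
  show "\<exists>A. open A \<and> x \<in> A \<and> (\<forall>y\<in>S. y \<in> A \<longrightarrow> f y \<in> B)"
    by (rule exI [of _ "A \<inter> U'"]) (use A U' U(2) in auto)
qed

lemma locally_path_connected_from_open_cover:
  assumes "\<And>x. x \<in> S \<Longrightarrow> \<exists>U. openin (top_of_set S) U \<and> x \<in> U \<and> locally path_connected U"
  shows "locally path_connected S"
  unfolding locally_path_connected
proof (intro allI impI, elim conjE)
  fix V x assume V: "openin (top_of_set S) V" and x: "x \<in> V"
  then have "x \<in> S" using openin_imp_subset by blast
  then obtain U where U: "openin (top_of_set S) U" "x \<in> U" "locally path_connected U"
    using assms by blast
  have "openin (top_of_set U) (U \<inter> V)"
    using U(1) V openin_imp_subset openin_subset_trans
    by (metis inf.cobounded1 openin_Int)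
  then obtain W where W: "openin (top_of_set U) W" "path_connected W" "x \<in> W" "W \<subseteq> U \<inter> V"
    using U x unfolding locally_path_connected by (meson IntI)
  then show "\<exists>W. openin (top_of_set S) W \<and> path_connected W \<and> x \<in> W \<and> W \<subseteq> V"
    using openin_trans U(1) by blast
qed

lemma covering_space_evenly_covered:
  assumes "covering_space C p S" "y \<in> S"
  obtains T \<V> where "openin (top_of_set S) T" "y \<in> T" "\<Union>\<V> = C \<inter> p -` T"
    "\<And>u. u \<in> \<V> \<Longrightarrow> openin (top_of_set C) u" "pairwise disjnt \<V>"
    "\<And>u. u \<in> \<V> \<Longrightarrow> \<exists>q. homeomorphism u T p q"
  using assms unfolding covering_space_def by (elim conjE) (drule (1) bspec, blast)

text \<open>
  Agreement of two lifts is an open condition because a sheet maps injectively, and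
  disagreement is open because distinct sheets are disjoint; connectedness leaves only one of them.
\<close>

lemma covering_space_lift_unique_topological:
  assumes cov: "covering_space C p S"
    and g1: "continuous_on K g1" "\<And>x. x \<in> K \<Longrightarrow> g1 x \<in> C"
    and g2: "continuous_on K g2" "\<And>x. x \<in> K \<Longrightarrow> g2 x \<in> C"
    and eq: "\<And>x. x \<in> K \<Longrightarrow> p (g1 x) = p (g2 x)"
    and K: "connected K" "a \<in> K" "x \<in> K" and a: "g1 a = g2 a"
  shows "g1 x = g2 x"
proof -
  have nbhd: "\<exists>W. openin (top_of_set K) W \<and> z \<in> W \<and> (\<forall>w\<in>W. g1 w = g2 w \<longleftrightarrow> g1 z = g2 z)"
    if z: "z \<in> K" for z
  proof -
    have "p (g1 z) \<in> S" using g1(2)[OF z] covering_space_imp_surjective[OF cov] by blast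
    then obtain T \<V> where T: "openin (top_of_set S) T" "p (g1 z) \<in> T" "\<Union>\<V> = C \<inter> p -` T"
      and op: "\<And>u. u \<in> \<V> \<Longrightarrow> openin (top_of_set C) u" and dis: "pairwise disjnt \<V>"
      and hom: "\<And>u. u \<in> \<V> \<Longrightarrow> \<exists>q. homeomorphism u T p q"
      using covering_space_evenly_covered[OF cov] by (metis (no_types, lifting))
    obtain u1 where u1: "u1 \<in> \<V>" "g1 z \<in> u1"
      using T g1(2)[OF z] by (metis IntI UnionE vimageI)
    obtain u2 where u2: "u2 \<in> \<V>" "g2 z \<in> u2"
      using T g2(2)[OF z] eq[OF z] by (metis IntI UnionE vimageI)
    have o1: "openin (top_of_set K) (K \<inter> g1 -` u1)"
      by (rule continuous_openin_preimage[OF g1(1) _ op[OF u1(1)]]) (use g1 in auto)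
    have o2: "openin (top_of_set K) (K \<inter> g2 -` u2)"
      by (rule continuous_openin_preimage[OF g2(1) _ op[OF u2(1)]]) (use g2 in auto)
    have "\<forall>w\<in>(K \<inter> g1 -` u1) \<inter> (K \<inter> g2 -` u2). g1 w = g2 w \<longleftrightarrow> u1 = u2"
    proof (intro ballI iffI)
      fix w assume w: "w \<in> (K \<inter> g1 -` u1) \<inter> (K \<inter> g2 -` u2)"
      { assume "g1 w = g2 w"
        then have "g1 w \<in> u1 \<inter> u2" using w by auto
        then show "u1 = u2" using dis u1(1) u2(1) by (auto simp: pairwise_def disjnt_def) }
      { assume "u1 = u2"
        obtain q where "homeomorphism u1 T p q" using hom u1 by blast
        then have "g1 w = q (p (g1 w))" "g2 w = q (p (g2 w))"
          using w \<open>u1 = u2\<close> by (auto simp: homeomorphism_def)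
        then show "g1 w = g2 w" using eq w by auto }
    qed
    then show ?thesis
      by (intro exI [of _ "(K \<inter> g1 -` u1) \<inter> (K \<inter> g2 -` u2)"])
        (use o1 o2 z u1 u2 in \<open>auto intro!: openin_Int\<close>)
  qed
  have op: "openin (top_of_set K) {z \<in> K. (g1 z = g2 z) = b}" for b
  proof (subst openin_subopen, intro ballI)
    fix z assume z: "z \<in> {z \<in> K. (g1 z = g2 z) = b}"
    then obtain W where W: "openin (top_of_set K) W" "z \<in> W" "\<forall>w\<in>W. g1 w = g2 w \<longleftrightarrow> g1 z = g2 z"
      using nbhd by blast
    then have "W \<subseteq> {z \<in> K. (g1 z = g2 z) = b}"
      using openin_imp_subset[OF W(1)] z by blast
    then show "\<exists>T. openin (top_of_set K) T \<and> z \<in> T \<and> T \<subseteq> {z \<in> K. (g1 z = g2 z) = b}"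
      using W by blast
  qed
  have cover: "K \<subseteq> {z \<in> K. (g1 z = g2 z) = True} \<union> {z \<in> K. (g1 z = g2 z) = False}"
    and disj: "{z \<in> K. (g1 z = g2 z) = True} \<inter> {z \<in> K. (g1 z = g2 z) = False} = {}"
    by auto
  have "{z \<in> K. (g1 z = g2 z) = True} = {} \<or> {z \<in> K. (g1 z = g2 z) = False} = {}"
    using K(1)[unfolded connected_openin] op[of True] op[of False] cover disj by meson
  then show ?thesis using K a by blast
qed

text \<open>
  The initial point ranges over all of \<open>K\<close>, so that lifts can be continued from a common point of two
  pieces in either direction.
\<close>

definition lifts_over where
  "lifts_over C p h K \<longleftrightarrow>
     (\<forall>k\<in>K. \<forall>e\<in>C. p e = h k \<longrightarrow>
        (\<exists>g. continuous_on K g \<and> (\<forall>x\<in>K. g x \<in> C \<and> p (g x) = h x) \<and> g k = e))"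

lemma lifts_over_Un_from_left:
  assumes cov: "covering_space C p S"
    and L: "lifts_over C p h K" "lifts_over C p h L"
    and cl: "closedin (top_of_set (K \<union> L)) K" "closedin (top_of_set (K \<union> L)) L"
    and conn: "connected (K \<inter> L)" "K \<inter> L \<noteq> {}"
    and k: "k \<in> K" "e \<in> C" "p e = h k"
  shows "\<exists>g. continuous_on (K \<union> L) g \<and> (\<forall>x\<in>K \<union> L. g x \<in> C \<and> p (g x) = h x) \<and> g k = e"
proof -
  obtain g1 where g1: "continuous_on K g1" "\<forall>x\<in>K. g1 x \<in> C \<and> p (g1 x) = h x" "g1 k = e"
    using L(1) k unfolding lifts_over_def by meson
  obtain z where z: "z \<in> K" "z \<in> L" using conn by blast
  obtain g2 where g2: "continuous_on L g2" "\<forall>x\<in>L. g2 x \<in> C \<and> p (g2 x) = h x" "g2 z = g1 z"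
    using L(2) g1(2) z unfolding lifts_over_def by meson
  have agree: "g1 x = g2 x" if "x \<in> K \<inter> L" for x
    by (rule covering_space_lift_unique_topological[OF cov, of "K \<inter> L" g1 g2 z])
      (use g1 g2 z that conn in \<open>auto intro: continuous_on_subset\<close>)
  define g where "g \<equiv> \<lambda>x. if x \<in> K then g1 x else g2 x"
  have gL: "g x = g2 x" if "x \<in> L" for x
    using agree that by (simp add: g_def)
  have "continuous_on (K \<union> L) g"
  proof (rule continuous_on_Un_local[OF cl])
    show "continuous_on K g"
      using g1(1) by (rule continuous_on_eq) (simp add: g_def)
    show "continuous_on L g"
      using g2(1) by (rule continuous_on_eq) (simp add: gL)
  qed
  moreover have "g x \<in> C \<and> p (g x) = h x" if "x \<in> K \<union> L" for x
    using g1(2) g2(2) that unfolding g_def by (cases "x \<in> K") simp_all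
  moreover have "g k = e" using g1(3) k(1) by (simp add: g_def)
  ultimately show ?thesis by (intro exI [of _ g]) blast
qed

lemma lifts_over_Un:
  assumes "covering_space C p S" "lifts_over C p h K" "lifts_over C p h L"
    and "closedin (top_of_set (K \<union> L)) K" "closedin (top_of_set (K \<union> L)) L"
    and "connected (K \<inter> L)" "K \<inter> L \<noteq> {}"
  shows "lifts_over C p h (K \<union> L)"
  unfolding lifts_over_def
proof (intro ballI impI)
  fix k e assume k: "k \<in> K \<union> L" "e \<in> C" "p e = h k"
  show "\<exists>g. continuous_on (K \<union> L) g \<and> (\<forall>x\<in>K \<union> L. g x \<in> C \<and> p (g x) = h x) \<and> g k = e"
  proof (cases "k \<in> K")
    case True
    then show ?thesis using lifts_over_Un_from_left[OF assms _ k(2,3)] by blast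
  next
    case False
    then have "k \<in> L" using k(1) by blast
    then have "\<exists>g. continuous_on (L \<union> K) g \<and> (\<forall>x\<in>L \<union> K. g x \<in> C \<and> p (g x) = h x) \<and> g k = e"
      using assms k(2,3) by (intro lifts_over_Un_from_left[of C p S]) (simp_all add: Un_commute Int_commute)
    then show ?thesis by (simp add: Un_commute)
  qed
qed

lemma lifts_over_evenly_covered:
  assumes cov: "covering_space C p S" and h: "continuous_on K h" "h ` K \<subseteq> T"
    and T: "\<Union>\<V> = C \<inter> p -` T" "\<And>u. u \<in> \<V> \<Longrightarrow> openin (top_of_set C) u"
      "\<And>u. u \<in> \<V> \<Longrightarrow> \<exists>q. homeomorphism u T p q"
  shows "lifts_over C p h K"
  unfolding lifts_over_def
proof (intro ballI impI)
  fix k e assume k: "k \<in> K" "e \<in> C" "p e = h k"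
  then have "e \<in> \<Union>\<V>" using T h by auto
  then obtain u where u: "u \<in> \<V>" "e \<in> u" by blast
  obtain q where q: "homeomorphism u T p q" using T u by blast
  have "u \<subseteq> C" using T(1) u by blast
  have "continuous_on K (q \<circ> h)"
    using q by (intro continuous_on_compose h(1) continuous_on_subset[OF homeomorphism_cont2 h(2)])
  moreover have "q (h k) = e" using k(3) q u(2) by (metis homeomorphism_def)
  moreover have "q (h x) \<in> C \<and> p (q (h x)) = h x" if "x \<in> K" for x
  proof -
    have "h x \<in> T" using h(2) that by blast
    then have "q (h x) \<in> u" "p (q (h x)) = h x" using q by (auto simp: homeomorphism_def)
    then show ?thesis using \<open>u \<subseteq> C\<close> by blast
  qed
  ultimately show "\<exists>g. continuous_on K g \<and> (\<forall>x\<in>K. g x \<in> C \<and> p (g x) = h x) \<and> g k = e"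
    by (intro exI [of _ "q \<circ> h"]) simp
qed

text \<open>
  Two nested bisection arguments: over short vertical intervals around a fixed height the
  lift is continued in the horizontal direction, and the resulting thin strips are stacked.
\<close>

lemma lifts_over_rectangle:
  fixes h :: "real \<times> real \<Rightarrow> 'b::topological_space"
  assumes cov: "covering_space C p S" and h: "continuous_on UNIV h" "range h \<subseteq> S"
    and le: "a \<le> b" "c \<le> d"
  shows "lifts_over C p h ({a..b} \<times> {c..d})"
proof -
  have small: "\<exists>\<epsilon>>0. \<forall>a b c d. a \<le> x \<and> x \<le> b \<and> b - a < \<epsilon> \<and> c \<le> y \<and> y \<le> d \<and> d - c < \<epsilon>
      \<longrightarrow> lifts_over C p h ({a..b} \<times> {c..d})" for x y
  proof -
    have "h (x,y) \<in> S" using h by blast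
    then obtain T \<V> where T: "openin (top_of_set S) T" "h (x,y) \<in> T" "\<Union>\<V> = C \<inter> p -` T"
      and op: "\<And>u. u \<in> \<V> \<Longrightarrow> openin (top_of_set C) u" and dis: "pairwise disjnt \<V>"
      and hom: "\<And>u. u \<in> \<V> \<Longrightarrow> \<exists>q. homeomorphism u T p q"
      using covering_space_evenly_covered[OF cov] by (metis (no_types, lifting))
    obtain T' where T': "open T'" "T = S \<inter> T'" using T(1) by (auto simp: openin_open)
    have "open (h -` T')" using h(1) T'(1) by (simp add: continuous_on_open_vimage)
    moreover have "(x,y) \<in> h -` T'" using T(2) T' by auto
    ultimately obtain A B where AB: "open A" "open B" "x \<in> A" "y \<in> B" "A \<times> B \<subseteq> h -` T'"
      by (metis mem_Sigma_iff open_prod_elim)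
    obtain e1 where e1: "e1 > 0" "ball x e1 \<subseteq> A" using AB openE by blast
    obtain e2 where e2: "e2 > 0" "ball y e2 \<subseteq> B" using AB openE by blast
    show ?thesis
    proof (intro exI [of _ "min e1 e2"] conjI allI impI)
      fix a b c d
      assume "a \<le> x \<and> x \<le> b \<and> b - a < min e1 e2 \<and> c \<le> y \<and> y \<le> d \<and> d - c < min e1 e2"
      then have "{a..b} \<subseteq> ball x e1" "{c..d} \<subseteq> ball y e2" by (auto simp: dist_real_def)
      then have "{a..b} \<times> {c..d} \<subseteq> h -` T'"
        using e1(2) e2(2) AB(5) by (meson Sigma_mono order_trans)
      then have "h ` ({a..b} \<times> {c..d}) \<subseteq> T"
        using T' h(2) by blast
      then show "lifts_over C p h ({a..b} \<times> {c..d})"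
        using lifts_over_evenly_covered[OF cov _ _ T(3) op hom] h(1) continuous_on_subset
        by blast
    qed (use e1 e2 in auto)
  qed
  have strip: "\<exists>\<epsilon>>0. \<forall>c d. c \<le> y \<and> y \<le> d \<and> d - c < \<epsilon> \<longrightarrow> lifts_over C p h ({a..b} \<times> {c..d})" for y
    using le(1)
  proof (induction rule: Bolzano)
    case (trans a b c)
    then obtain \<epsilon>1 \<epsilon>2 where \<epsilon>: "\<epsilon>1 > 0" "\<epsilon>2 > 0"
      and 1: "\<And>u v. u \<le> y \<and> y \<le> v \<and> v - u < \<epsilon>1 \<Longrightarrow> lifts_over C p h ({a..b} \<times> {u..v})"
      and 2: "\<And>u v. u \<le> y \<and> y \<le> v \<and> v - u < \<epsilon>2 \<Longrightarrow> lifts_over C p h ({b..c} \<times> {u..v})"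
      by metis
    have "lifts_over C p h ({a..c} \<times> {u..v})" if uv: "u \<le> y \<and> y \<le> v \<and> v - u < min \<epsilon>1 \<epsilon>2" for u v
    proof -
      have un: "{a..c} \<times> {u..v} = {a..b} \<times> {u..v} \<union> {b..c} \<times> {u..v}"
        using trans(3,4) by auto
      have int: "({a..b} \<times> {u..v}) \<inter> ({b..c} \<times> {u..v}) = {b} \<times> {u..v}"
        using trans(3,4) by auto
      show ?thesis unfolding un
      proof (rule lifts_over_Un[OF cov])
        show "connected (({a..b} \<times> {u..v}) \<inter> ({b..c} \<times> {u..v}))"
          unfolding int by (intro connected_Times) auto
      qed (use 1 2 uv int in \<open>auto intro!: closed_subset closed_Times\<close>)
    qed
    then show ?case using \<epsilon> by (intro exI [of _ "min \<epsilon>1 \<epsilon>2"]) auto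
  next
    case (local x)
    obtain \<epsilon> where "\<epsilon> > 0" "\<forall>a b c d. a \<le> x \<and> x \<le> b \<and> b - a < \<epsilon> \<and> c \<le> y \<and> y \<le> d \<and> d - c < \<epsilon>
      \<longrightarrow> lifts_over C p h ({a..b} \<times> {c..d})" using small by blast
    then show ?case by blast
  qed
  show ?thesis
    using le(2)
  proof (induction rule: Bolzano)
    case (trans u v w)
    have un: "{a..b} \<times> {u..w} = {a..b} \<times> {u..v} \<union> {a..b} \<times> {v..w}"
      using trans(3,4) by auto
    have int: "({a..b} \<times> {u..v}) \<inter> ({a..b} \<times> {v..w}) = {a..b} \<times> {v}"
      using trans(3,4) by auto
    show ?case unfolding un
    proof (rule lifts_over_Un[OF cov])
      show "connected (({a..b} \<times> {u..v}) \<inter> ({a..b} \<times> {v..w}))"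
        unfolding int by (intro connected_Times) auto
    qed (use trans le(1) int in \<open>auto intro!: closed_subset closed_Times\<close>)
  next
    case (local y)
    show ?case using strip[of y] by blast
  qed
qed

lemma homeomorphism_locally_path_connected:
  assumes hom: "homeomorphism U T p q" and T: "locally path_connected T"
  shows "locally path_connected U"
  unfolding locally_path_connected
proof (intro allI impI, elim conjE)
  fix V x assume V: "openin (top_of_set U) V" "x \<in> V"
  have VU: "V \<subseteq> U" using V(1) openin_imp_subset by blast
  have "openin (top_of_set T) (p ` V)" by (rule homeomorphism_imp_open_map[OF hom V(1)])
  then obtain W where W: "openin (top_of_set T) W" "path_connected W" "p x \<in> W" "W \<subseteq> p ` V"
    using T V(2) unfolding locally_path_connected by (meson imageI)
  have qp: "q (p y) = y" if "y \<in> V" for y using hom VU that by (auto simp: homeomorphism_def)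
  show "\<exists>W. openin (top_of_set U) W \<and> path_connected W \<and> x \<in> W \<and> W \<subseteq> V"
  proof (intro exI conjI)
    show "openin (top_of_set U) (q ` W)"
      by (rule homeomorphism_imp_open_map[OF homeomorphism_symD[OF hom] W(1)])
    show "path_connected (q ` W)"
      using openin_imp_subset[OF W(1)] homeomorphism_cont2[OF hom] W(2)
      by (meson continuous_on_subset path_connected_continuous_image)
    show "x \<in> q ` W" using W(3) qp[OF V(2)] by force
    show "q ` W \<subseteq> V" using W(4) qp by force
  qed
qed

lemma covering_space_locally_path_connected_total:
  assumes cov: "covering_space C p S" and S: "locally path_connected S"
  shows "locally path_connected C"
proof (rule locally_path_connected_from_open_cover)
  fix x assume "x \<in> C"
  then obtain U T q where "x \<in> U" "openin (top_of_set C) U" "openin (top_of_set S) T" "homeomorphism U T p q"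
    using covering_space_local_homeomorphism[OF cov] by metis
  then show "\<exists>U. openin (top_of_set C) U \<and> x \<in> U \<and> locally path_connected U"
    using homeomorphism_locally_path_connected locally_open_subset[OF S] by blast
qed

text \<open>
  Precomposition with the retraction of the plane onto the unit square makes \<open>h\<close> continuous on the
  whole plane.
\<close>

lemma covering_space_lift_square:
  fixes h :: "real \<times> real \<Rightarrow> 'b::topological_space"
  assumes cov: "covering_space C p S"
    and h: "continuous_on ({0..1} \<times> {0..1}) h" "h ` ({0..1} \<times> {0..1}) \<subseteq> S"
    and e: "e \<in> C" "p e = h (0, 0)"
  shows "\<exists>g. continuous_on ({0..1} \<times> {0..1}) g \<and> g (0, 0) = e \<and>
    (\<forall>s\<in>{0..1}. \<forall>t\<in>{0..1}. g (s, t) \<in> C \<and> p (g (s, t)) = h (s, t))"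
proof -
  define \<kappa> :: "real \<Rightarrow> real" where "\<kappa> t = max 0 (min 1 t)" for t
  define h' where "h' = (\<lambda>(s, t). h (\<kappa> s, \<kappa> t))"
  have \<kappa>: "\<kappa> t \<in> {0..1}" for t by (auto simp: \<kappa>_def)
  have \<kappa>_id: "\<kappa> t = t" if "t \<in> {0..1}" for t using that by (auto simp: \<kappa>_def)
  have "continuous_on UNIV (\<lambda>x. h (\<kappa> (fst x), \<kappa> (snd x)))"
    by (rule continuous_on_compose2[OF h(1)])
      (use \<kappa> in \<open>auto simp: \<kappa>_def intro!: continuous_intros\<close>)
  then have "continuous_on UNIV h'" by (simp add: h'_def case_prod_unfold)
  moreover have "range h' \<subseteq> S"
    using h(2) \<kappa> unfolding h'_def by (auto simp del: atLeastAtMost_iff)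
  ultimately have "lifts_over C p h' ({0..1} \<times> {0..1})"
    by (intro lifts_over_rectangle[OF cov]) auto
  moreover have "p e = h' (0, 0)" using e by (simp add: h'_def \<kappa>_id)
  ultimately obtain g where g: "continuous_on ({0..1} \<times> {0..1}) g"
      "\<forall>x\<in>{0..1} \<times> {0..1}. g x \<in> C \<and> p (g x) = h' x" "g (0, 0) = e"
    using e(1) unfolding lifts_over_def by (metis SigmaI atLeastAtMost_iff order_refl zero_le_one)
  have "g (s, t) \<in> C \<and> p (g (s, t)) = h (s, t)" if st: "s \<in> {0..1}" "t \<in> {0..1}" for s t
  proof -
    have "g (s, t) \<in> C \<and> p (g (s, t)) = h' (s, t)" using g(2) st by blast
    then show ?thesis using st by (simp add: h'_def \<kappa>_id)
  qed
  then show ?thesis using g(1,3) by blast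
qed

lemma covering_space_lift_path_topological:
  assumes cov: "covering_space C p S" and c: "path c" "path_image c \<subseteq> S"
    and e: "e \<in> C" "p e = pathstart c"
  shows "\<exists>k. path k \<and> path_image k \<subseteq> C \<and> pathstart k = e \<and> (\<forall>t\<in>{0..1}. p (k t) = c t)"
proof -
  have "continuous_on ({0..1::real} \<times> {0..1::real}) (\<lambda>x. c (snd x))"
    by (rule continuous_on_compose2[of "{0..1}" c]) (use c in \<open>auto simp: path_def intro!: continuous_intros\<close>)
  moreover have "(\<lambda>x. c (snd x)) ` ({0..1::real} \<times> {0..1::real}) \<subseteq> S"
    using c by (auto simp: path_image_def)
  moreover have "p e = c (snd (0 :: real, 0))" using e by (simp add: pathstart_def)
  ultimately have "\<exists>g. continuous_on ({0..1::real} \<times> {0..1::real}) g \<and> g (0, 0) = e \<and>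
      (\<forall>s\<in>{0..1}. \<forall>t\<in>{0..1}. g (s, t) \<in> C \<and> p (g (s, t)) = c (snd (s, t)))"
    by (rule covering_space_lift_square[OF cov _ _ e(1), where h = "\<lambda>x. c (snd x)"])
  then obtain g where g: "continuous_on ({0..1::real} \<times> {0..1::real}) g" "g (0, 0) = e"
      "\<forall>s\<in>{0..1}. \<forall>t\<in>{0..1}. g (s, t) \<in> C \<and> p (g (s, t)) = c (snd (s, t))"
    by (elim exE conjE)
  have "continuous_on {0..1} (\<lambda>t. g (0, t))"
    by (rule continuous_on_compose2[OF g(1)]) (auto intro!: continuous_intros)
  then show ?thesis
    by (intro exI [of _ "\<lambda>t. g (0, t)"]) (use g in \<open>auto simp: path_def path_image_def pathstart_def\<close>)
qed

text \<open>
  In the lift of a free homotopy from \<open>c\<close> to a constant loop, the tracks of the two end points agree: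
  both lift the same path, and they meet over the constant loop.
\<close>

lemma covering_space_lift_loop_closed:
  assumes cov: "covering_space C p S" and U: "simply_connected U"
    and f: "continuous_on U f" "f ` U \<subseteq> S"
    and c: "path c" "path_image c \<subseteq> U" "pathfinish c = pathstart c"
    and k: "path k" "path_image k \<subseteq> C" "\<And>t. t \<in> {0..1} \<Longrightarrow> p (k t) = f (c t)"
  shows "pathfinish k = pathstart k"
proof -
  have c0: "c 0 \<in> U" using c(2) by (auto simp: path_image_def)
  have "homotopic_loops U c (\<lambda>_. c 0)"
    by (rule U[unfolded simply_connected_def, rule_format])
      (use c c0 in \<open>auto simp: path_def path_image_def pathstart_def pathfinish_def\<close>)
  then obtain h where h: "continuous_on ({0..1::real} \<times> {0..1}) h" "h \<in> {0..1} \<times> {0..1} \<rightarrow> U"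
      "\<forall>x\<in>{0..1}. h (0, x) = c x" "\<forall>x\<in>{0..1}. h (1, x) = c 0"
      "\<forall>t\<in>{0..1}. pathfinish (h \<circ> Pair t) = pathstart (h \<circ> Pair t)"
    unfolding homotopic_loops by blast
  have hU: "h ` ({0..1} \<times> {0..1}) \<subseteq> U" using h(2) by blast
  have k_in: "k t \<in> C" if "t \<in> {0..1}" for t using k(2) that by (auto simp: path_image_def)
  have "continuous_on ({0..1} \<times> {0..1}) (f \<circ> h)"
    by (rule continuous_on_compose[OF h(1) continuous_on_subset[OF f(1) hU]])
  moreover have "(f \<circ> h) ` ({0..1} \<times> {0..1}) \<subseteq> S" using hU f(2) by fastforce
  moreover have "k 0 \<in> C" "p (k 0) = (f \<circ> h) (0, 0)" using k_in k(3)[of 0] h(3) by simp_all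
  ultimately have "\<exists>L. continuous_on ({0..1} \<times> {0..1}) L \<and> L (0, 0) = k 0 \<and>
      (\<forall>s\<in>{0..1}. \<forall>t\<in>{0..1}. L (s, t) \<in> C \<and> p (L (s, t)) = (f \<circ> h) (s, t))"
    by (rule covering_space_lift_square[OF cov])
  then obtain L where L: "continuous_on ({0..1} \<times> {0..1}) L" "L (0, 0) = k 0"
      "\<forall>s\<in>{0..1}. \<forall>t\<in>{0..1}. L (s, t) \<in> C \<and> p (L (s, t)) = (f \<circ> h) (s, t)"
    by (elim exE conjE)
  have horizontal: "continuous_on {0..1} (\<lambda>s. L (s, t))" if "t \<in> {0..1}" for t
    by (rule continuous_on_compose2[OF L(1)]) (use that in \<open>auto intro!: continuous_intros\<close>)
  have vertical: "continuous_on {0..1} (\<lambda>t. L (s, t))" if "s \<in> {0..1}" for s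
    by (rule continuous_on_compose2[OF L(1)]) (use that in \<open>auto intro!: continuous_intros\<close>)
  have conn: "connected {0..1::real}" by simp
  note unique = covering_space_lift_unique_topological[OF cov _ _ _ _ _ conn]
  have "L (0, 1) = k 1"
    by (rule unique[of "\<lambda>t. L (0, t)" k 0 1])
      (use vertical[of 0] k k_in L h(3) in \<open>auto simp: path_def\<close>)
  moreover have "L (1, 1) = L (1, 0)"
    by (rule unique[of "\<lambda>t. L (1, t)" "\<lambda>t. L (1, 0)" 0 1])
      (use vertical[of 1] L h(4) in auto)
  then have "L (0, 0) = L (0, 1)"
    by (intro unique[of "\<lambda>s. L (s, 0)" "\<lambda>s. L (s, 1)" 1 0])
      (use horizontal[of 0] horizontal[of 1] L h(5) in \<open>auto simp: pathstart_def pathfinish_def\<close>)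
  ultimately show ?thesis using L(2) by (simp add: pathstart_def pathfinish_def)
qed

text \<open>
  The two paths form a loop, whose lift is closed; read backwards from its end, its second half
  is the lift of the second path.
\<close>

lemma covering_space_lift_same_finish:
  assumes cov: "covering_space C p S" and U: "simply_connected U"
    and f: "continuous_on U f" "f ` U \<subseteq> S"
    and c: "path c" "path_image c \<subseteq> U" and c': "path c'" "path_image c' \<subseteq> U"
    and cc': "pathstart c = pathstart c'" "pathfinish c = pathfinish c'"
    and k: "path k" "path_image k \<subseteq> C" "\<And>t. t \<in> {0..1} \<Longrightarrow> p (k t) = f (c t)"
    and k': "path k'" "path_image k' \<subseteq> C" "\<And>t. t \<in> {0..1} \<Longrightarrow> p (k' t) = f (c' t)"
    and kk': "pathstart k = pathstart k'"
  shows "pathfinish k = pathfinish k'"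
proof -
  let ?c = "c +++ reversepath c'"
  have pc: "path ?c" "path_image ?c \<subseteq> U" "pathfinish ?c = pathstart ?c"
    using c c' cc' by (simp_all add: subset_path_image_join)
  have "f ` path_image ?c \<subseteq> S" "continuous_on (path_image ?c) f"
    using pc f by (auto intro: continuous_on_subset)
  then have fc: "path (f \<circ> ?c)" "path_image (f \<circ> ?c) \<subseteq> S"
    using pc by (auto intro: path_continuous_image simp: path_image_compose)
  have k0: "k 0 \<in> C" and k'_in: "\<And>t. t \<in> {0..1} \<Longrightarrow> k' t \<in> C" and k_in: "\<And>t. t \<in> {0..1} \<Longrightarrow> k t \<in> C"
    using k(2) k'(2) by (auto simp: path_image_def)
  have pk0: "p (k 0) = pathstart (f \<circ> ?c)"
    using k(3)[of 0] by (simp add: pathstart_def joinpaths_def)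
  obtain K where K: "path K" "path_image K \<subseteq> C" "pathstart K = k 0"
      "\<forall>t\<in>{0..1}. p (K t) = (f \<circ> ?c) t"
    using covering_space_lift_path_topological[OF cov fc k0 pk0] by (elim exE conjE)
  have K_in: "K t \<in> C" if "t \<in> {0..1}" for t using K(2) that by (auto simp: path_image_def)
  have "pathfinish K = pathstart K"
    by (rule covering_space_lift_loop_closed[OF cov U f pc K(1,2)]) (use K(4) in auto)
  then have K1: "K 1 = k' 0" using K(3) kk' by (simp add: pathstart_def pathfinish_def)
  have contK: "continuous_on {0..1} K" using K(1) by (simp add: path_def)
  have conn: "connected {0..1::real}" by simp
  note unique = covering_space_lift_unique_topological[OF cov _ _ _ _ _ conn]
  have "K (1 / 2) = k 1"
  proof (rule unique[of "\<lambda>t. K (t / 2)" k 0 1, simplified])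
    show "continuous_on {0..1} (\<lambda>t. K (t / 2))"
      by (rule continuous_on_compose2[OF contK]) (auto intro!: continuous_intros)
    show "p (K (t / 2)) = p (k t)" if "0 \<le> t \<and> t \<le> 1" for t
      using K(4)[rule_format, of "t / 2"] k(3)[of t] that by (simp add: joinpaths_def)
  qed (use K_in k_in k K(3) in \<open>auto simp: path_def pathstart_def\<close>)
  moreover have "K (1 / 2) = k' 1"
  proof -
    have "K (1 - 1 / 2) = k' 1"
    proof (rule unique[of "\<lambda>t. K (1 - t / 2)" k' 0 1])
      show "continuous_on {0..1} (\<lambda>t. K (1 - t / 2))"
        by (rule continuous_on_compose2[OF contK]) (auto intro!: continuous_intros)
      show "p (K (1 - t / 2)) = p (k' t)" if t: "t \<in> {0..1}" for t
      proof (cases "t = 1")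
        case True
        then show ?thesis
          using K(4)[rule_format, of "1/2"] k'(3)[of 1] cc'(2) by (simp add: joinpaths_def pathfinish_def)
      next
        case False
        then show ?thesis using K(4)[rule_format, of "1 - t / 2"] k'(3)[of t] t
          by (auto simp: joinpaths_def reversepath_def algebra_simps)
      qed
    qed (use K_in k'_in k' K1 in \<open>auto simp: path_def\<close>)
    then show ?thesis by simp
  qed
  ultimately show ?thesis by (simp add: pathfinish_def)
qed

lemma simply_connected_imp_path_connected_topological:
  assumes "simply_connected S" shows "path_connected S"
  unfolding path_connected_def
proof (intro ballI)
  fix x y assume "x \<in> S" "y \<in> S"
  then have "homotopic_loops S (\<lambda>_. x) (\<lambda>_. y)"
    by (intro assms[unfolded simply_connected_def, rule_format])
      (auto simp: path_def path_image_def pathstart_def pathfinish_def)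
  then obtain h where h: "continuous_on ({0..1::real} \<times> {0..1::real}) h" "h \<in> {0..1} \<times> {0..1} \<rightarrow> S"
      "\<forall>t\<in>{0..1}. h (0, t) = x" "\<forall>t\<in>{0..1}. h (1, t) = y"
    unfolding homotopic_loops by blast
  have "continuous_on {0..1} (\<lambda>s. h (s, 0))"
    by (rule continuous_on_compose2[OF h(1)]) (auto intro!: continuous_intros)
  then show "\<exists>g. path g \<and> path_image g \<subseteq> S \<and> pathstart g = x \<and> pathfinish g = y"
    by (intro exI [of _ "\<lambda>s. h (s, 0)"])
      (use h in \<open>auto simp: path_def path_image_def pathstart_def pathfinish_def\<close>)
qed

text \<open>
  The value at \<open>x\<close> is the end of the lift of any path from \<open>z\<close> to \<open>x\<close>. Near \<open>x\<close> the
  paths may be prolonged inside a path connected set that \<open>f\<close> maps into an evenly covered one, so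
  that there the lift is \<open>f\<close> followed by the inverse of a sheet, which is continuous.
\<close>

theorem covering_space_lift_simply_connected:
  assumes cov: "covering_space C p S"
    and U: "simply_connected U" "locally path_connected U"
    and f: "continuous_on U f" "f ` U \<subseteq> S"
    and z: "z \<in> U" and a: "a \<in> C" "p a = f z"
  obtains g where "continuous_on U g" "g ` U \<subseteq> C" "\<And>x. x \<in> U \<Longrightarrow> p (g x) = f x" "g z = a"
proof -
  define ends where "ends x e \<longleftrightarrow> (\<exists>c k. path c \<and> path_image c \<subseteq> U \<and> pathstart c = z \<and> pathfinish c = x \<and>
      path k \<and> path_image k \<subseteq> C \<and> pathstart k = a \<and> pathfinish k = e \<and> (\<forall>t\<in>{0..1}. p (k t) = f (c t)))"
    for x e
  have ends_unique: "e = e'" if "ends x e" "ends x e'" for x e e'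
  proof -
    obtain c k where 1: "path c" "path_image c \<subseteq> U" "pathstart c = z" "pathfinish c = x"
      "path k" "path_image k \<subseteq> C" "pathstart k = a" "pathfinish k = e" "\<And>t. t\<in>{0..1} \<Longrightarrow> p (k t) = f (c t)"
      using \<open>ends x e\<close> unfolding ends_def by blast
    obtain c' k' where 2: "path c'" "path_image c' \<subseteq> U" "pathstart c' = z" "pathfinish c' = x"
      "path k'" "path_image k' \<subseteq> C" "pathstart k' = a" "pathfinish k' = e'" "\<And>t. t\<in>{0..1} \<Longrightarrow> p (k' t) = f (c' t)"
      using \<open>ends x e'\<close> unfolding ends_def by blast
    have "pathfinish k = pathfinish k'"
      by (rule covering_space_lift_same_finish[OF cov U(1) f 1(1,2) 2(1,2) _ _ 1(5,6,9) 2(5,6,9)])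
        (simp_all only: 1(3,4,7) 2(3,4,7))
    then show ?thesis by (simp only: 1(8) 2(8))
  qed
  have ends_exist: "\<exists>e. ends x e" if x: "x \<in> U" for x
  proof -
    obtain c where c: "path c" "path_image c \<subseteq> U" "pathstart c = z" "pathfinish c = x"
      using simply_connected_imp_path_connected_topological[OF U(1), unfolded path_connected_def,
          THEN bspec, OF z, THEN bspec, OF x] by (elim exE conjE)
    have "f ` path_image c \<subseteq> S" "continuous_on (path_image c) f"
      using c f by (auto intro: continuous_on_subset)
    then have fc: "path (f \<circ> c)" "path_image (f \<circ> c) \<subseteq> S"
      using c by (auto intro: path_continuous_image simp: path_image_compose)
    have pa: "p a = pathstart (f \<circ> c)" using a(2) c(3) by (simp add: pathstart_compose)
    obtain k where "path k" "path_image k \<subseteq> C" "pathstart k = a" "\<forall>t\<in>{0..1}. p (k t) = (f \<circ> c) t"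
      using covering_space_lift_path_topological[OF cov fc a(1) pa] by (elim exE conjE)
    then have "ends x (pathfinish k)"
      unfolding ends_def by (intro exI [of _ c] exI [of _ k]) (use c in auto)
    then show ?thesis by blast
  qed
  define g where "g x = (THE e. ends x e)" for x
  have g: "ends x (g x)" if "x \<in> U" for x
    unfolding g_def using ends_exist[OF that] ends_unique by (blast intro: theI)
  have g_eq: "g x = e" if "ends x e" for x e
    unfolding g_def using that ends_unique by blast
  have pg: "g x \<in> C" "p (g x) = f x" if x: "x \<in> U" for x
  proof -
    obtain c k where ck: "pathfinish c = x" "path_image k \<subseteq> C" "pathfinish k = g x"
        "\<forall>t\<in>{0..1}. p (k t) = f (c t)"
      using g[OF x] unfolding ends_def by (elim exE conjE)
    show "g x \<in> C" using ck(2,3) pathfinish_in_path_image[of k] by auto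
    show "p (g x) = f x" using ck(4)[rule_format, of 1] ck(1,3) by (simp add: pathfinish_def)
  qed
  have "ends z a"
    unfolding ends_def
    by (intro exI [of _ "\<lambda>_. z"] exI [of _ "\<lambda>_. a"])
      (use z a in \<open>auto simp: path_def path_image_def pathstart_def pathfinish_def\<close>)
  then have gz: "g z = a" by (rule g_eq)
  have "continuous_on U g"
  proof (rule continuous_on_locally)
    fix x assume x: "x \<in> U"
    obtain u T q where u: "g x \<in> u" "openin (top_of_set C) u" "p (g x) \<in> T"
        "openin (top_of_set S) T" and q: "homeomorphism u T p q"
      by (rule covering_space_local_homeomorphism[OF cov pg(1)[OF x]])
    have uC: "u \<subseteq> C" using u(2) by (rule openin_imp_subset)
    have "openin (top_of_set U) (U \<inter> f -` T)"
      by (rule continuous_openin_preimage[OF f(1) _ u(4)]) (use f in auto)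
    moreover have "x \<in> U \<inter> f -` T" using x u(3) pg(2)[OF x] by simp
    ultimately obtain V where V: "openin (top_of_set U) V" "path_connected V" "x \<in> V" "V \<subseteq> U \<inter> f -` T"
      using U(2) unfolding locally_path_connected by meson
    have contqf: "continuous_on V (q \<circ> f)"
      by (intro continuous_on_compose continuous_on_subset[OF f(1)] continuous_on_subset[OF homeomorphism_cont2[OF q]])
        (use V(4) in auto)
    have q_in: "q (f y) \<in> C" and pq: "p (q (f y)) = f y" if "y \<in> V" for y
    proof -
      have "f y \<in> T" using V(4) that by blast
      then have "q (f y) \<in> u" "p (q (f y)) = f y" using q by (auto simp: homeomorphism_def)
      then show "q (f y) \<in> C" "p (q (f y)) = f y" using uC by auto
    qed
    have qfx: "q (f x) = g x" using q u(1) pg(2)[OF x] by (metis homeomorphism_apply1)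
    have "g w = q (f w)" if w: "w \<in> V" for w
    proof -
      obtain c k where ck: "path c" "path_image c \<subseteq> U" "pathstart c = z" "pathfinish c = x"
        "path k" "path_image k \<subseteq> C" "pathstart k = a" "pathfinish k = g x" "\<And>t. t\<in>{0..1} \<Longrightarrow> p (k t) = f (c t)"
        using g[OF x] unfolding ends_def by blast
      obtain s where s: "path s" "path_image s \<subseteq> V" "pathstart s = x" "pathfinish s = w"
        using V(2,3) w unfolding path_connected_def by blast
      have qs: "path ((q \<circ> f) \<circ> s)" "path_image ((q \<circ> f) \<circ> s) \<subseteq> C"
        using s q_in by (auto intro!: path_continuous_image continuous_on_subset[OF contqf] simp: path_image_compose)
      have sU: "path_image s \<subseteq> U" using s(2) V(4) by blast
      have "ends w (q (f w))"
        unfolding ends_def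
      proof (intro exI conjI ballI)
        show "path (c +++ s)" "path_image (c +++ s) \<subseteq> U" "pathstart (c +++ s) = z" "pathfinish (c +++ s) = w"
          using ck s sU by (simp_all add: subset_path_image_join)
        show "path (k +++ ((q \<circ> f) \<circ> s))" "path_image (k +++ ((q \<circ> f) \<circ> s)) \<subseteq> C"
          "pathstart (k +++ ((q \<circ> f) \<circ> s)) = a" "pathfinish (k +++ ((q \<circ> f) \<circ> s)) = q (f w)"
          using ck s qs qfx
          by (simp_all add: subset_path_image_join pathstart_compose pathfinish_compose)
        fix t :: real assume t: "t \<in> {0..1}"
        have "s (2 * t - 1) \<in> V" if "\<not> t \<le> 1/2"
          using s(2) t that by (auto simp: path_image_def)
        then show "p ((k +++ ((q \<circ> f) \<circ> s)) t) = f ((c +++ s) t)"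
          using ck(9)[of "2 * t"] t pq by (auto simp: joinpaths_def)
      qed
      then show ?thesis by (rule g_eq)
    qed
    then have "continuous_on V g" using contqf by (metis (no_types, lifting) comp_apply continuous_on_cong)
    then show "\<exists>V. openin (top_of_set U) V \<and> x \<in> V \<and> continuous_on V g" using V by blast
  qed
  then show ?thesis by (rule that) (use pg gz in auto)
qed

section \<open>Deck transformations and functions on the base\<close>

text \<open>
  Lifting the covering map through itself, once with \<open>e\<close> going to \<open>e'\<close> and once with \<open>e'\<close>
  going to \<open>e\<close>, gives two maps that are inverse to each other by uniqueness of lifts.
\<close>

lemma deck_group_transitive_on_fibres:
  assumes cov: "covering_space C p S" and C: "simply_connected C" "locally path_connected C"
    and e: "e \<in> C" "e' \<in> C" "p e = p e'"
  obtains \<gamma> where "\<gamma> \<in> carrier (deck_group C p)" "\<gamma> e = e'"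
proof -
  have p: "continuous_on C p" "p ` C \<subseteq> S"
    using cov by (auto simp: covering_space_def)
  have conn: "connected C"
    using C(1) by (intro path_connected_imp_connected simply_connected_imp_path_connected_topological)
  have lift: "\<exists>g. continuous_on C g \<and> g ` C \<subseteq> C \<and> (\<forall>x\<in>C. p (g x) = p x) \<and> g b = d"
    if "b \<in> C" "d \<in> C" "p d = p b" for b d
    using covering_space_lift_simply_connected[OF cov C p that] by metis
  obtain g where g: "continuous_on C g" "g ` C \<subseteq> C" "\<forall>x\<in>C. p (g x) = p x" "g e = e'"
    using lift e by metis
  obtain g' where g': "continuous_on C g'" "g' ` C \<subseteq> C" "\<forall>x\<in>C. p (g' x) = p x" "g' e' = e"
    using lift e by metis
  have inverse: "j (i x) = x" if "x \<in> C"
    and "continuous_on C i" "i ` C \<subseteq> C" "\<forall>x\<in>C. p (i x) = p x"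
    and "continuous_on C j" "j ` C \<subseteq> C" "\<forall>x\<in>C. p (j x) = p x" "b \<in> C" "j (i b) = b" for i j b x
  proof (rule covering_space_lift_unique_topological[OF cov _ _ _ _ _ conn \<open>b \<in> C\<close> \<open>x \<in> C\<close>])
    show "continuous_on C (\<lambda>x. j (i x))"
      by (rule continuous_on_compose2[OF that(5,2,3)])
  qed (use that in auto)
  have gg': "g' (g x) = x" "g (g' x) = x" if "x \<in> C" for x
    using inverse[OF that g(1-3) g'(1-3) e(1)] inverse[OF that g'(1-3) g(1-3) e(2)] g(4) g'(4) by auto
  \<comment> \<open>elements of \<open>Bij C\<close> are extensional\<close>
  define \<gamma> where "\<gamma> = restrict g C"
  have "homeomorphism C C g g'"
    by (rule homeomorphismI) (use g g' gg' in auto)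
  then have "homeomorphism C C \<gamma> g'"
    by (rule homeomorphism_cong) (auto simp: \<gamma>_def)
  moreover have "bij_betw \<gamma> C C"
    by (rule bij_betw_byWitness[of _ g']) (use g g' gg' in \<open>auto simp: \<gamma>_def\<close>)
  ultimately have "\<gamma> \<in> carrier (deck_group C p)"
    using g(3) by (auto simp: deck_group_def lifted_group_def Bij_def \<gamma>_def)
  then show ?thesis by (rule that) (use e g(4) in \<open>simp add: \<gamma>_def\<close>)
qed

text \<open>
  The function descends to the base; continuity is seen through the inverse of a sheet.
\<close>

lemma compact_base_attains_max_of_invariant:
  fixes \<phi> :: "'e::topological_space \<Rightarrow> real"
  assumes cov: "covering_space C p S" and S: "compact S" "S \<noteq> {}"
    and \<phi>: "continuous_on C \<phi>" "\<And>x y. x \<in> C \<Longrightarrow> y \<in> C \<Longrightarrow> p x = p y \<Longrightarrow> \<phi> x = \<phi> y"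
  shows "\<exists>e\<in>C. \<forall>x\<in>C. \<phi> x \<le> \<phi> e"
proof -
  have onto: "p ` C = S" by (rule covering_space_imp_surjective[OF cov])
  define F where "F = \<phi> \<circ> inv_into C p"
  have F: "F (p x) = \<phi> x" if "x \<in> C" for x
    unfolding F_def comp_def using that by (intro \<phi>(2)) (auto simp: inv_into_into f_inv_into_f)
  have "continuous_on S F"
  proof (rule continuous_on_locally)
    fix y assume "y \<in> S"
    then obtain x u T q where "p x = y" "x \<in> u" and u: "openin (top_of_set C) u"
        and T: "y \<in> T" "openin (top_of_set S) T" and q: "homeomorphism u T p q"
      by (rule covering_space_local_homeomorphism_alt[OF cov])
    have uC: "u \<subseteq> C" using u by (rule openin_imp_subset)
    have qT: "q ` T = u" using q by (simp add: homeomorphism_def)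
    have "continuous_on T (\<phi> \<circ> q)"
      using uC qT by (intro continuous_on_compose homeomorphism_cont2[OF q] continuous_on_subset[OF \<phi>(1)]) simp
    moreover have "(\<phi> \<circ> q) t = F t" if "t \<in> T" for t
      using F[of "q t"] qT uC that homeomorphism_apply2[OF q that] by auto
    ultimately have "continuous_on T F" by (rule continuous_on_eq)
    then show "\<exists>T. openin (top_of_set S) T \<and> y \<in> T \<and> continuous_on T F" using T by blast
  qed
  then obtain y where y: "y \<in> S" "\<And>y'. y' \<in> S \<Longrightarrow> F y' \<le> F y"
    using continuous_attains_sup[OF S] by blast
  then obtain e where e: "e \<in> C" "y = p e" using onto by blast
  show ?thesis
  proof (intro bexI[OF _ e(1)] ballI)
    fix x assume "x \<in> C"
    then show "\<phi> x \<le> \<phi> e" using y(2)[of "p x"] e F onto by auto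
  qed
qed

section \<open>Closed manifolds modelled on the pseudosphere\<close>

lemma gx_structure_locally_path_connected:
  assumes gx: "gx_structure G X M \<A>" and X: "locally path_connected X"
  shows "locally path_connected M"
proof (rule locally_path_connected_from_open_cover)
  fix m assume "m \<in> M"
  then obtain U \<phi> where U: "(U, \<phi>) \<in> \<A>" "m \<in> U" using gx unfolding gx_structure_def by blast
  then obtain V \<phi>' where "openin (top_of_set M) U" "openin (top_of_set X) V" "homeomorphism U V \<phi> \<phi>'"
    using gx unfolding gx_structure_def by blast
  then show "\<exists>U. openin (top_of_set M) U \<and> m \<in> U \<and> locally path_connected U"
    using U(2) homeomorphism_locally_path_connected locally_open_subset[OF X] by blast
qed

text \<open>
  Near \<open>e\<close> the developing map is the covering map followed by a chart and an element of \<open>G\<close>, each of which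
  maps open sets to open sets. Thus a maximum over the universal covering becomes a local maximum
  on \<open>X\<close>.
\<close>

lemma developing_map_open_image_near:
  assumes gx: "gx_structure G X M \<A>" and cov: "covering_space Mt \<pi> M"
    and dev: "developing_map G \<A> Mt \<pi> Xt r \<delta>"
    and G: "\<And>g. g \<in> G \<Longrightarrow> \<exists>g'. homeomorphism X X g g'"
    and e: "e \<in> Mt"
  shows "\<exists>B. openin (top_of_set X) B \<and> r (\<delta> e) \<in> B \<and> B \<subseteq> (\<lambda>m. r (\<delta> m)) ` Mt"
proof -
  have "\<pi> e \<in> M" using e cov by (auto simp: covering_space_def)
  then obtain U \<phi> where U: "(U, \<phi>) \<in> \<A>" "\<pi> e \<in> U" using gx unfolding gx_structure_def by blast
  then obtain V \<phi>' where V: "openin (top_of_set M) U" "openin (top_of_set X) V" "homeomorphism U V \<phi> \<phi>'"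
    using gx unfolding gx_structure_def by blast
  obtain W g where W: "g \<in> G" "openin (top_of_set Mt) W" "e \<in> W" "\<pi> ` W \<subseteq> U"
      "\<forall>w\<in>W. r (\<delta> w) = g (\<phi> (\<pi> w))"
    using dev U e unfolding developing_map_def by blast
  obtain u T q where u: "e \<in> u" "openin (top_of_set Mt) u" "openin (top_of_set M) T" "homeomorphism u T \<pi> q"
    using covering_space_local_homeomorphism[OF cov e] by metis
  obtain g' where g': "homeomorphism X X g g'" using G W(1) by blast
  have "openin (top_of_set u) (u \<inter> W)"
    by (rule openin_subset_trans[OF openin_Int[OF u(2) W(2)] Int_lower1 openin_imp_subset[OF u(2)]])
  then have "openin (top_of_set T) (\<pi> ` (u \<inter> W))" by (rule homeomorphism_imp_open_map[OF u(4)])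
  then have "openin (top_of_set M) (\<pi> ` (u \<inter> W))" using openin_trans u(3) by blast
  then have "openin (top_of_set U) (\<pi> ` (u \<inter> W))"
    by (rule openin_subset_trans) (use W(4) openin_imp_subset[OF V(1)] in auto)
  then have "openin (top_of_set V) (\<phi> ` \<pi> ` (u \<inter> W))" by (rule homeomorphism_imp_open_map[OF V(3)])
  then have "openin (top_of_set X) (\<phi> ` \<pi> ` (u \<inter> W))" using openin_trans V(2) by blast
  then have "openin (top_of_set X) (g ` \<phi> ` \<pi> ` (u \<inter> W))" by (rule homeomorphism_imp_open_map[OF g'])
  then have op: "openin (top_of_set X) ((\<lambda>m. r (\<delta> m)) ` (u \<inter> W))"
    using W(5) by (simp add: image_image)
  have "u \<inter> W \<subseteq> Mt" using u(2) openin_imp_subset by blast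
  then show ?thesis by (intro exI [of _ "(\<lambda>m. r (\<delta> m)) ` (u \<inter> W)"] conjI op) (use u(1) W(3) in auto)
qed

lemma holonomy_equivariance:
  assumes hol: "holonomy_morphism G Mt \<pi> Xt r \<delta> \<rho>" and \<delta>: "\<delta> \<in> Mt \<rightarrow> Xt"
    and \<gamma>: "\<gamma> \<in> carrier (deck_group Mt \<pi>)"
  shows "\<exists>g \<in> projected_group G Xt r (holonomy_group Mt \<pi> \<rho>). \<forall>m\<in>Mt. r (\<delta> (\<gamma> m)) = g (r (\<delta> m))"
proof -
  have "\<rho> \<gamma> \<in> carrier (lifted_group G Xt r)"
    using hol \<gamma> by (auto simp: holonomy_morphism_def hom_def)
  then obtain g where g: "g \<in> G" "\<forall>x\<in>Xt. r (\<rho> \<gamma> x) = g (r x)"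
    by (auto simp: lifted_group_def)
  show ?thesis
  proof (intro bexI ballI)
    show "g \<in> projected_group G Xt r (holonomy_group Mt \<pi> \<rho>)"
      using g \<gamma> by (auto simp: projected_group_def holonomy_group_def)
    show "r (\<delta> (\<gamma> m)) = g (r (\<delta> m))" if "m \<in> Mt" for m
      using hol \<gamma> that g(2) \<delta> by (auto simp: holonomy_morphism_def)
  qed
qed

theorem corollary6p1:
  fixes p q :: nat
    and N :: "'n::finite set"
    and M :: "'m::t2_space set"
    and \<A> :: "('m set \<times> ('m \<Rightarrow> real ^ 'n)) set"
    and Mt :: "'u::topological_space set" and \<pi> :: "'u \<Rightarrow> 'm"
    and Xt :: "'v::topological_space set" and r :: "'v \<Rightarrow> real ^ 'n"
    and \<delta> :: "'u \<Rightarrow> 'v" and \<rho> :: "('u \<Rightarrow> 'u) \<Rightarrow> ('v \<Rightarrow> 'v)"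
  assumes "card (- N) = p + 1" and "card N = q" and "q \<noteq> 0"
    and "compact M" and "connected M" and "M \<noteq> {}"
    and "gx_structure (linear_isometries N) (pseudosphere N) M \<A>"
    and "universal_covering Mt \<pi> M"
    and "universal_covering Xt r (pseudosphere N)"
    and "developing_map (linear_isometries N) \<A> Mt \<pi> Xt r \<delta>"
    and "holonomy_morphism (linear_isometries N) Mt \<pi> Xt r \<delta> \<rho>"
  shows "\<not> (\<exists>V1 V2. nondegenerate_splitting N V1 V2 \<and>
            preserves_splitting
              (projected_group (linear_isometries N) Xt r (holonomy_group Mt \<pi> \<rho>)) V1 V2)"
proof
  let ?G = "linear_isometries N" and ?X = "pseudosphere N"
  assume "\<exists>V1 V2. nondegenerate_splitting N V1 V2 \<and>
            preserves_splitting (projected_group ?G Xt r (holonomy_group Mt \<pi> \<rho>)) V1 V2"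
  then obtain V V2 where split: "nondegenerate_splitting N V V2"
      and inv: "preserves_splitting (projected_group ?G Xt r (holonomy_group Mt \<pi> \<rho>)) V V2"
    by blast
  have V: "subspace V" "nondegenerate_on N V" "V \<noteq> {0}"
    using split by (auto simp: nondegenerate_splitting_def)
  have "V2 \<noteq> {0}" "V \<inter> V2 = {0}" using split by (auto simp: nondegenerate_splitting_def)
  then have V_UNIV: "V \<noteq> UNIV" by auto
  have N: "N \<noteq> {}" using assms(2,3) by auto

  have cov: "covering_space Mt \<pi> M" and cov_X: "covering_space Xt r ?X"
    using assms(8,9) by (auto simp: universal_covering_def)
  have "components M = {M}" using assms(5,6) by (simp add: components_eq_sing_iff)
  moreover have "Mt \<inter> \<pi> -` M = Mt" using cov by (auto simp: covering_space_def)
  ultimately have sc: "simply_connected Mt" using assms(8) by (simp add: universal_covering_def)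
  have lpc: "locally path_connected Mt"
    using covering_space_locally_path_connected_total[OF cov]
      gx_structure_locally_path_connected[OF assms(7) locally_path_connected_pseudosphere] by blast
  have \<delta>: "continuous_on Mt \<delta>" "\<delta> \<in> Mt \<rightarrow> Xt"
    using assms(10) by (auto simp: developing_map_def)

  define F where "F m = pform N (pproj N V (r (\<delta> m))) (pproj N V (r (\<delta> m)))" for m
  have cont_P: "continuous_on A (pproj N V)" for A
    using linear_pproj[OF V(1,2)] by (simp add: linear_continuous_on linear_linear)
  have cont_D: "continuous_on Mt (\<lambda>m. r (\<delta> m))"
    by (rule continuous_on_compose2[OF covering_space_imp_continuous[OF cov_X] \<delta>(1)]) (use \<delta> in auto)
  have cont_F: "continuous_on Mt F"
    unfolding F_def by (intro continuous_on_pform continuous_on_compose2[OF cont_P[of UNIV] cont_D]) auto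
  have F_fibre: "F m = F m'" if m: "m \<in> Mt" "m' \<in> Mt" "\<pi> m = \<pi> m'" for m m'
  proof -
    obtain \<gamma> where \<gamma>: "\<gamma> \<in> carrier (deck_group Mt \<pi>)" "\<gamma> m = m'"
      by (rule deck_group_transitive_on_fibres[OF cov sc lpc m])
    obtain g where g: "g \<in> projected_group ?G Xt r (holonomy_group Mt \<pi> \<rho>)"
        "\<forall>m\<in>Mt. r (\<delta> (\<gamma> m)) = g (r (\<delta> m))"
      using holonomy_equivariance[OF assms(11) \<delta>(2) \<gamma>(1)] by (elim bexE)
    have gG: "g \<in> ?G" and gV: "g ` V \<subseteq> V"
      using g(1) inv by (auto simp: projected_group_def preserves_splitting_def)
    have "r (\<delta> m') = g (r (\<delta> m))" using g(2)[rule_format, OF m(1)] by (simp only: \<gamma>(2))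
    then have "pproj N V (r (\<delta> m')) = g (pproj N V (r (\<delta> m)))"
      by (simp add: pproj_isometry[OF V(1,2) gG gV])
    then show ?thesis using gG by (simp add: F_def linear_isometries_def)
  qed
  have G_homeo: "\<exists>g'. homeomorphism ?X ?X g g'" if "g \<in> ?G" for g
    using linear_isometries_homeomorphism_pseudosphere[OF that] by blast
  have image_near: "\<exists>W. openin (top_of_set ?X) W \<and> r (\<delta> m) \<in> W \<and> W \<subseteq> (\<lambda>m. r (\<delta> m)) ` Mt"
    if "m \<in> Mt" for m
    by (rule developing_map_open_image_near[OF assms(7) cov assms(10) _ that]) (rule G_homeo)

  have "\<exists>e\<in>Mt. \<forall>m\<in>Mt. F m \<le> F e"
    by (rule compact_base_attains_max_of_invariant[OF cov assms(4,6) cont_F F_fibre])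
  then obtain e where e: "e \<in> Mt" "\<forall>m\<in>Mt. F m \<le> F e" by (elim bexE)
  have "continuous_on Mt (\<lambda>m. - F m)" using cont_F by (intro continuous_intros)
  moreover have "- F m = - F m'" if "m \<in> Mt" "m' \<in> Mt" "\<pi> m = \<pi> m'" for m m'
    using F_fibre[OF that] by simp
  ultimately have "\<exists>e\<in>Mt. \<forall>m\<in>Mt. - F m \<le> - F e"
    by (rule compact_base_attains_max_of_invariant[OF cov assms(4,6)])
  then obtain e' where e': "e' \<in> Mt" "\<forall>m\<in>Mt. - F m \<le> - F e'" by (elim bexE)
  obtain W where W: "openin (top_of_set ?X) W" "r (\<delta> e) \<in> W" "W \<subseteq> (\<lambda>m. r (\<delta> m)) ` Mt"
    using image_near[OF e(1)] by (elim exE conjE)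
  obtain W' where W': "openin (top_of_set ?X) W'" "r (\<delta> e') \<in> W'" "W' \<subseteq> (\<lambda>m. r (\<delta> m)) ` Mt"
    using image_near[OF e'(1)] by (elim exE conjE)
  show False
  proof (rule no_local_extrema_of_pproj[OF V V_UNIV N W(1,2) _ W'(1,2)])
    fix y
    show "pform N (pproj N V y) (pproj N V y) \<le> pform N (pproj N V (r (\<delta> e))) (pproj N V (r (\<delta> e)))"
      if "y \<in> W"
    proof -
      obtain m where "m \<in> Mt" "y = r (\<delta> m)" using W(3) \<open>y \<in> W\<close> by blast
      then show ?thesis using e(2) by (simp add: F_def)
    qed
    show "pform N (pproj N V (r (\<delta> e'))) (pproj N V (r (\<delta> e'))) \<le> pform N (pproj N V y) (pproj N V y)"
      if "y \<in> W'"
    proof -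
      obtain m where "m \<in> Mt" "y = r (\<delta> m)" using W'(3) \<open>y \<in> W'\<close> by blast
      then show ?thesis using e'(2) by (simp add: F_def)
    qed
  qed
qed

end
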